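(* Let $d\ge 1$, $\alpha>0$, and let $\nu$ be a measure on the unit sphere $S^{d-1}\subset\mathbb{R}^d$ with $\nu(S^{d-1})=1$, supported by a finite set of distinct unit vectors $e^{(1)},\ldots,e^{(l)}$, with atoms $\nu_i=\nu(\{e^{(i)}\})>0$, $i=1,\ldots,l$, and such that $\mathrm{cone}\{e^{(1)},\ldots,e^{(l)}\}=\mathbb{R}^d$. Let $\pi_{\alpha,\nu}$ be the Poisson point process on $\mathbb{R}^d\setminus\{\mathbf 0\}$ with intensity measure $\mu=\theta\times\nu$, where $\theta$ has density $\alpha r^{-\alpha-1}$, $r>0$. Let $C_k(\pi_{\alpha,\nu})$ be the $k$-th convex hull in the peeling procedure applied to $\pi_{\alpha,\nu}$. Let $A=\{\nu_1^{1/\alpha}e^{(1)},\ldots,\nu_l^{1/\alpha}e^{(l)}\}$ and let $C_\infty=C(A)$ be its convex hull. If $A$ is extreme, then, as $k\to\infty$, $$d_H\left(k^{1/\alpha}C_k(\pi_{\alpha,\nu}),\,C_\infty\right)=O\left(\sqrt{\frac{\ln\ln k}{k}}\right)\quad\text{a.s.},$$ that is, almost surely there are a finite (random) constant $M$ and a (random) integer $K\geq 3$ such that the left-hand side is at most $M\sqrt{\ln\ln k/k}$ for all $k\ge K$. Moreover, the polyhedron $C_\infty$ determines the limit shape of the convex hulls $C_k(\pi_{\alpha,\nu})$: with $\rho_k=\max_{x\in C_k(\pi_{\alpha,\nu})}|x|$ and $\rho_\infty=\max_{x\in C_\infty}|x|$, one has $d_H\left(\rho_k^{-1}C_k(\pi_{\alpha,\nu}),\,\rho_\infty^{-1}C_\infty\right)\to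 0$ a.s. as $k\to\infty$.
   Context: Notation: $|x|$ is the Euclidean norm; $d_H$ is the Hausdorff distance between compact subsets of $\mathbb{R}^d$; $C(B)$ is the convex hull of $B\subset\mathbb{R}^d$; $\mathrm{ext}\,C$ is the set of extreme points of a convex set $C$ (the vertices if $C$ is a convex polyhedron); $\mathrm{cone}(B)$ is the (convex) cone generated by $B$, i.e. the set of all finite nonnegative linear combinations of elements of $B$. Intensity measure: $\mathbb{R}^d\setminus\{\mathbf 0\}$ is identified with $(0,\infty)\times S^{d-1}$ via $x\mapsto(|x|,x/|x|)$, and $\mu=\theta\times\nu$ means $\mu\{x:\ |x|\in B,\ x/|x|\in E\}=\theta(B)\nu(E)$ for Borel sets $B\subset(0,\infty)$, $E\subset S^{d-1}$. In the present case the process is a superposition of $l$ independent one-dimensional Poisson point processes on the rays $\{te^{(i)}:t>0\}$ with intensities $\nu_i\alpha r^{-\alpha-1}\,dr$. Peeling procedure: let $\varsigma_1$ be the (random) set of points of $\pi_{\alpha,\nu}$. Recursively, $C_k=C_k(\pi_{\alpha,\nu})=C(\varsigma_k)$ and $\varsigma_{k+1}=\varsigma_k\setminus\mathrm{ext}\,C_k$, $k=1,2,\ldots$. Almost surely all $C_k$ are polyhedra containing $\mathbf 0$. Extreme set: a finite set $A=\{a^{(1)},\ldots,a^{(m)}\}\subset\mathbb{R}^d$ with $m\ge d+1$ is called extreme if $\mathrm{ext}\,C(A)=A$. Limit shape: with $\rho_k=\max_{x\in C_k}|x|$, the limit shape of the sequence $(C_k)$ is the non-random set $\hat C$ (if it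 exists) such that $d_H(\rho_k^{-1}C_k,\hat C)\to0$ a.s. *)

theory Defs
  imports "HOL-Probability.Probability"
begin

section \<open>Poisson point processes\<close>

text \<open>
  A Poisson point process is taken to be a random countable set, so that points have no
  multiplicities. This is no restriction for intensity measures without atoms, such as the one
  below. Counts take values in \<^typ>\<open>ennreal\<close>, because a set of infinite intensity almost surely
  contains infinitely many points.
\<close>

definition point_count :: "('w \<Rightarrow> 'a set) \<Rightarrow> 'a set \<Rightarrow> 'w \<Rightarrow> ennreal" where
  "point_count \<xi> B \<omega> = emeasure (count_space UNIV) (\<xi> \<omega> \<inter> B)"

locale poisson_process = prob_space M for M :: "'w measure" +
  fixes \<mu> :: "'a measure" and \<xi> :: "'w \<Rightarrow> 'a set"
  assumes countable_points: "\<omega> \<in> space M \<Longrightarrow> countable (\<xi> \<omega>)"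
    and points_in_space: "\<omega> \<in> space M \<Longrightarrow> \<xi> \<omega> \<subseteq> space \<mu>"
    and random_variable_count: "B \<in> sets \<mu> \<Longrightarrow> random_variable borel (point_count \<xi> B)"
    and poisson_count:
      "\<lbrakk>B \<in> sets \<mu>; emeasure \<mu> B < \<infinity>\<rbrakk> \<Longrightarrow>
        prob {\<omega> \<in> space M. point_count \<xi> B \<omega> = of_nat k} =
          exp (- measure \<mu> B) * measure \<mu> B ^ k / fact k"
    and infinite_count:
      "\<lbrakk>B \<in> sets \<mu>; emeasure \<mu> B = \<infinity>\<rbrakk> \<Longrightarrow> AE \<omega> in M. point_count \<xi> B \<omega> = \<infinity>"
    and indep_counts:
      "\<lbrakk>\<And>i. i < n \<Longrightarrow> D i \<in> sets \<mu>; disjoint_family_on D {..<n}\<rbrakk> \<Longrightarrow>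
        indep_vars (\<lambda>_. borel) (\<lambda>i. point_count \<xi> (D i)) {..<n::nat}"

section \<open>The intensity measure\<close>

definition radial_measure :: "real \<Rightarrow> real measure" where
  "radial_measure \<alpha> =
     density (restrict_space lborel {0<..}) (\<lambda>r. ennreal (\<alpha> * r powr (- \<alpha> - 1)))"

text \<open>
  The product of the radial and the spherical measure, transported to the punctured space by the
  inverse \<open>(r, u) \<mapsto> r u\<close> of polar coordinates; \<open>emeasure_polar_intensity\<close> below gives its
  values on polar rectangles. The spherical measure \<open>\<nu>\<close> is a measure on the space
  \<^term>\<open>sphere 0 1\<close> with the trace of the Borel sets.
\<close>

definition polar_intensity :: "real \<Rightarrow> 'a::euclidean_space measure \<Rightarrow> 'a measure" where
  "polar_intensity \<alpha> \<nu> =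
     distr (radial_measure \<alpha> \<Otimes>\<^sub>M \<nu>) (restrict_space borel (- {0})) (\<lambda>(r, u). r *\<^sub>R u)"

lemma measurable_polar:
  fixes \<nu> :: "'a::euclidean_space measure"
  assumes "sets \<nu> = sets (restrict_space borel (sphere 0 1))"
  shows "(\<lambda>(r, u). r *\<^sub>R u) \<in> radial_measure \<alpha> \<Otimes>\<^sub>M \<nu> \<rightarrow>\<^sub>M restrict_space borel (- {0})"
proof -
  have space_nu: "space \<nu> = sphere 0 1"
    using sets_eq_imp_space_eq[OF assms] by (simp add: space_restrict_space)
  have [measurable]: "(\<lambda>x. x) \<in> radial_measure \<alpha> \<rightarrow>\<^sub>M borel"
    unfolding radial_measure_def
    by (simp add: measurable_restrict_space1)
  have "(\<lambda>x. x) \<in> restrict_space borel (sphere (0::'a) 1) \<rightarrow>\<^sub>M borel"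
    by (simp add: measurable_restrict_space1)
  then have [measurable]: "(\<lambda>x. x) \<in> \<nu> \<rightarrow>\<^sub>M borel"
    by (simp only: measurable_cong_sets[OF assms refl])
  have "(\<lambda>p. fst p *\<^sub>R snd p) \<in> radial_measure \<alpha> \<Otimes>\<^sub>M \<nu> \<rightarrow>\<^sub>M borel"
    by measurable
  then show ?thesis
    by (intro measurable_restrict_space2)
      (auto simp: space_pair_measure space_nu radial_measure_def space_restrict_space
        case_prod_beta)
qed

lemma emeasure_polar_intensity:
  fixes \<nu> :: "'a::euclidean_space measure"
  assumes "prob_space \<nu>" and nu: "sets \<nu> = sets (restrict_space borel (sphere 0 1))"
    and B: "B \<in> sets borel" "B \<subseteq> {0<..}" and E: "E \<in> sets borel" "E \<subseteq> sphere 0 1"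
  shows "emeasure (polar_intensity \<alpha> \<nu>) {x. norm x \<in> B \<and> x /\<^sub>R norm x \<in> E} =
    emeasure (radial_measure \<alpha>) B * emeasure \<nu> E"
proof -
  interpret prob_space \<nu> by fact
  let ?X = "{x. norm x \<in> B \<and> x /\<^sub>R norm x \<in> E}"
  have space_nu: "space \<nu> = sphere 0 1"
    using sets_eq_imp_space_eq[OF nu] by (simp add: space_restrict_space)
  have X: "?X \<in> sets (restrict_space borel (- {0}))"
  proof -
    have "(\<lambda>x. x /\<^sub>R norm x) -` E \<inter> space borel \<in> sets (borel :: 'a measure)"
      by (rule measurable_sets[OF _ E(1)]) simp
    moreover have "norm -` B \<inter> space borel \<in> sets (borel :: 'a measure)"
      by (rule measurable_sets[OF _ B(1)]) simp
    ultimately have "(norm -` B) \<inter> ((\<lambda>x. x /\<^sub>R norm x) -` E) \<in> sets (borel :: 'a measure)"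
      by simp
    moreover have "?X = (norm -` B) \<inter> ((\<lambda>x. x /\<^sub>R norm x) -` E)" by auto
    ultimately show ?thesis
      using B(2) by (auto simp: sets_restrict_space_iff)
  qed
  have "(\<lambda>(r, u). r *\<^sub>R u) -` ?X \<inter> space (radial_measure \<alpha> \<Otimes>\<^sub>M \<nu>) = B \<times> E"
    using B(2) E(2)
    by (auto simp: space_pair_measure space_nu radial_measure_def space_restrict_space
        subset_iff)
  moreover have "B \<in> sets (radial_measure \<alpha>)" "E \<in> sets \<nu>"
    using B E by (auto simp: radial_measure_def nu sets_restrict_space_iff)
  ultimately show ?thesis
    unfolding polar_intensity_def
    using X by (simp add: emeasure_distr[OF measurable_polar[OF nu]] emeasure_pair_measure_Times)
qed

section \<open>Cones\<close>

text \<open>The convex cone hull consists of the finite nonnegative linear combinations.\<close>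

lemma convex_cone_hull_explicit:
  fixes S :: "'a::real_vector set"
  shows "convex_cone hull S =
    {\<Sum>x\<in>F. c x *\<^sub>R x | F c. finite F \<and> F \<subseteq> S \<and> (\<forall>x\<in>F. 0 \<le> c x)}" (is "_ = ?R")
proof
  show "convex_cone hull S \<subseteq> ?R"
  proof (rule hull_minimal)
    show "S \<subseteq> ?R"
    proof
      fix x assume "x \<in> S"
      then show "x \<in> ?R"
        by (intro CollectI exI[of _ "{x}"] exI[of _ "\<lambda>_. 1"]) auto
    qed
    have scale: "a *\<^sub>R u \<in> ?R" if "u \<in> ?R" "0 \<le> a" for a u
    proof -
      from that(1) obtain F c where *: "u = (\<Sum>x\<in>F. c x *\<^sub>R x)" "finite F" "F \<subseteq> S"
        "\<forall>x\<in>F. 0 \<le> c x" by blast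
      then show ?thesis
        using that(2)
        by (intro CollectI exI[of _ F] exI[of _ "\<lambda>x. a * c x"]) (auto simp: scaleR_sum_right)
    qed
    have add: "u + v \<in> ?R" if "u \<in> ?R" "v \<in> ?R" for u v
    proof -
      from that(1) obtain F c where F: "u = (\<Sum>x\<in>F. c x *\<^sub>R x)" "finite F" "F \<subseteq> S"
        "\<forall>x\<in>F. 0 \<le> c x" by blast
      from that(2) obtain G b where G: "v = (\<Sum>x\<in>G. b x *\<^sub>R x)" "finite G" "G \<subseteq> S"
        "\<forall>x\<in>G. 0 \<le> b x" by blast
      let ?c = "\<lambda>x. (if x \<in> F then c x else 0)" and ?b = "\<lambda>x. (if x \<in> G then b x else 0)"
      have "u = (\<Sum>x\<in>F \<union> G. ?c x *\<^sub>R x)"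
        unfolding F(1) using F(2) G(2) by (intro sum.mono_neutral_cong_left) auto
      moreover have "v = (\<Sum>x\<in>F \<union> G. ?b x *\<^sub>R x)"
        unfolding G(1) using F(2) G(2) by (intro sum.mono_neutral_cong_left) auto
      ultimately have "u + v = (\<Sum>x\<in>F \<union> G. (?c x + ?b x) *\<^sub>R x)"
        by (simp only: sum.distrib scaleR_add_left)
      then show ?thesis
        using F G by (intro CollectI exI[of _ "F \<union> G"] exI[of _ "\<lambda>x. ?c x + ?b x"]) auto
    qed
    have "0 \<in> ?R"
      by (intro CollectI exI[of _ "{}"]) auto
    then show "convex_cone ?R"
      unfolding convex_cone_iff by (intro conjI ballI allI impI add scale)
  qed
next
  show "?R \<subseteq> convex_cone hull S"
  proof clarify
    fix F c
    assume "finite F" "F \<subseteq> S" "\<forall>x\<in>F. 0 \<le> (c x :: real)"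
    then show "(\<Sum>x\<in>F. c x *\<^sub>R x) \<in> convex_cone hull S"
    proof (induction F rule: finite_induct)
      case empty
      show ?case by (simp add: convex_cone_hull_contains_0)
    next
      case (insert x F)
      have "c x *\<^sub>R x \<in> convex_cone hull S"
        using insert.prems by (intro convex_cone_hull_mul hull_inc) simp_all
      moreover have "(\<Sum>x\<in>F. c x *\<^sub>R x) \<in> convex_cone hull S"
        using insert by simp
      ultimately show ?case
        unfolding sum.insert[OF insert.hyps] by (rule convex_cone_hull_add)
    qed
  qed
qed

section \<open>Peeling\<close>

definition ext :: "'a::real_vector set \<Rightarrow> 'a set" where
  "ext C = {x. x extreme_point_of C}"

text \<open>Rounds are numbered from 1: \<^term>\<open>peel_points S 0\<close> is only a start value.\<close>

fun peel_points :: "'a::real_vector set \<Rightarrow> nat \<Rightarrow> 'a set" where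
  "peel_points S 0 = S"
| "peel_points S (Suc 0) = S"
| "peel_points S (Suc (Suc k)) =
     peel_points S (Suc k) - ext (convex hull (peel_points S (Suc k)))"

definition peel_hull :: "'a::real_vector set \<Rightarrow> nat \<Rightarrow> 'a set" where
  "peel_hull S k = convex hull (peel_points S k)"

definition extreme_set :: "'a::euclidean_space set \<Rightarrow> bool" where
  "extreme_set A \<longleftrightarrow> finite A \<and> DIM('a) + 1 \<le> card A \<and> ext (convex hull A) = A"

section \<open>Distances and radii\<close>

text \<open>Both are meaningful for nonempty compact sets only.\<close>

definition hausdorff_distance :: "'a::metric_space set \<Rightarrow> 'a set \<Rightarrow> real" where
  "hausdorff_distance A B = max (SUP a\<in>A. infdist a B) (SUP b\<in>B. infdist b A)"

definition max_norm :: "'a::real_normed_vector set \<Rightarrow> real" where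
  "max_norm A = (SUP x\<in>A. norm x)"

end

theory Submission
  imports Defs "HOL-Real_Asymp.Real_Asymp"
begin

text \<open>
  In the coordinate \<open>u\<close>, the points of the process on the ray through \<open>e\<^sub>i\<close> are
  \<open>u powr (-1 / \<alpha>) *\<^sub>R a\<^sub>i\<close> with \<open>a\<^sub>i \<in> A\<close>, where \<open>u\<close> runs through a Poisson process of unit
  rate; an upper law of the iterated logarithm gives \<open>U\<^sub>i\<^sub>j = j + O(sqrt (j ln (ln j)))\<close> for its
  \<open>j\<close>-th point. In each round at most the outermost remaining point of each ray is removed. As
  \<open>A\<close> is extreme, such a point is certainly removed when its ray has lost the fewest points so far,
  provided that every ray has lost enough points. So, from some round on, the smallest number of
  removed points grows by one in each round, and before round \<open>k\<close> every ray has lost \<open>k - O(1)\<close>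
  points. Hence \<open>C\<^sub>k\<close> is spanned by the points \<open>U\<^sub>i\<^sub>j powr (-1 / \<alpha>) *\<^sub>R a\<^sub>i\<close> with
  \<open>j = k - O(1)\<close>.
\<close>

section \<open>Hausdorff distance of convex hulls of finite families\<close>

text \<open>The obstacle is that extremality of \<open>A\<close> says nothing about early hulls,
  where the radii on different rays are not comparable. It becomes usable in a robust form: a factor
  1 + \<epsilon> between the scales still leaves each point outside the hull of the others. A ray
  that lags behind has its outermost point at a comparatively large radius, so this slack and the
  law of the iterated logarithm together force it to advance. The early rounds are bridged by a
  different argument: a point of maximal norm is always removed. The rate survives because an index
  error O(1) is dominated by sqrt (k ln (ln k)), and a power of U / k is Lipschitz near 1. Since
  only the order of the fluctuations matters, Chernoff bounds, a maximal inequality on dyadic blocks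
  and Borel-Cantelli suffice on each ray.\<close>

lemma convex_hull_image_close:
  fixes b :: "'i \<Rightarrow> 'a::euclidean_space"
  assumes d: "\<And>i. i \<in> I \<Longrightarrow> norm (b i - c i) \<le> d"
    and x: "x \<in> convex hull (b ` I)"
  shows "infdist x (convex hull (c ` I)) \<le> d"
proof -
  let ?C = "convex hull (c ` I)"
  \<comment> \<open>The union is the Minkowski sum of \<open>?C\<close> and a ball of radius
    \<open>d\<close>. It is convex, so it contains the hull as soon as it contains the
    generators.\<close>
  have "b i \<in> (\<Union>u\<in>?C. \<Union>v\<in>cball 0 d. {u + v})" if "i \<in> I" for i
    using d[OF that] that
    by (intro UN_I[of "c i"] UN_I[of "b i - c i"]) (auto intro: hull_inc)
  then have "convex hull (b ` I) \<subseteq> (\<Union>u\<in>?C. \<Union>v\<in>cball 0 d. {u + v})"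
    by (intro hull_minimal convex_sums) auto
  with x obtain u v where uv: "x = u + v" "u \<in> ?C" "norm v \<le> d" by auto
  have "infdist x ?C \<le> dist x u" by (rule infdist_le) fact
  with uv show ?thesis by (simp add: dist_norm)
qed

lemma hausdorff_distance_convex_hull_image:
  fixes b :: "'i \<Rightarrow> 'a::euclidean_space"
  assumes I: "finite I" "I \<noteq> {}" and d: "\<And>i. i \<in> I \<Longrightarrow> norm (b i - c i) \<le> d"
  shows "hausdorff_distance (convex hull (b ` I)) (convex hull (c ` I)) \<le> d"
  unfolding hausdorff_distance_def
proof (rule max.boundedI; rule cSUP_least)
  show "infdist x (convex hull (c ` I)) \<le> d" if "x \<in> convex hull (b ` I)" for x
    using convex_hull_image_close[OF d that] .
  have "norm (c i - b i) \<le> d" if "i \<in> I" for i using d[OF that] by (simp add: norm_minus_commute)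
  then show "infdist x (convex hull (b ` I)) \<le> d" if "x \<in> convex hull (c ` I)" for x
    using convex_hull_image_close[OF _ that] by blast
qed (use I in auto)

lemma hausdorff_distance_nonneg:
  fixes A B :: "'a::euclidean_space set"
  assumes "compact A" "A \<noteq> {}"
  shows "0 \<le> hausdorff_distance A B"
proof -
  obtain a where "a \<in> A" using assms by auto
  have "bounded ((\<lambda>a. infdist a B) ` A)"
    using assms by (intro compact_imp_bounded compact_continuous_image continuous_intros)
  then have "infdist a B \<le> (SUP a\<in>A. infdist a B)"
    using \<open>a \<in> A\<close> by (intro cSUP_upper bounded_imp_bdd_above)
  with infdist_nonneg[of a B] show ?thesis unfolding hausdorff_distance_def by linarith
qed

section \<open>Maximal norms and normalised hulls\<close>

lemma max_norm_convex_hull_image: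
  fixes b :: "'i \<Rightarrow> 'a::euclidean_space"
  assumes I: "finite I" "I \<noteq> {}"
  shows "max_norm (convex hull (b ` I)) = Max ((\<lambda>i. norm (b i)) ` I)"
proof (rule antisym)
  let ?m = "Max ((\<lambda>i. norm (b i)) ` I)"
  have sub: "convex hull (b ` I) \<subseteq> cball 0 ?m"
    using I by (intro hull_minimal) auto
  then show "max_norm (convex hull (b ` I)) \<le> ?m"
    unfolding max_norm_def using I by (intro cSUP_least) auto
  have "?m \<in> (\<lambda>i. norm (b i)) ` I" using I by (intro Max_in) auto
  then obtain i where "i \<in> I" "?m = norm (b i)" by auto
  moreover have "norm (b i) \<le> max_norm (convex hull (b ` I))"
    unfolding max_norm_def using sub \<open>i \<in> I\<close>
    by (intro cSUP_upper hull_inc) (auto intro!: bdd_aboveI[of _ ?m])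
  ultimately show "?m \<le> max_norm (convex hull (b ` I))" by simp
qed

lemma tendsto_Max_image:
  fixes f :: "'i \<Rightarrow> 'b \<Rightarrow> real"
  assumes "finite I" "I \<noteq> {}" "\<And>i. i \<in> I \<Longrightarrow> (f i \<longlongrightarrow> L i) F"
  shows "((\<lambda>x. Max ((\<lambda>i. f i x) ` I)) \<longlongrightarrow> Max (L ` I)) F"
  using assms
proof (induction I rule: finite_ne_induct)
  case (insert i I)
  then have "((\<lambda>x. max (f i x) (Max ((\<lambda>i. f i x) ` I))) \<longlongrightarrow> max (L i) (Max (L ` I))) F"
    by (intro tendsto_max) auto
  then show ?case using insert.hyps by simp
qed simp

text \<open>Dividing by the maximal norm cancels the common factor
  \<open>real k powr \<beta>\<close>, which leaves the generators \<open>c k i *\<^sub>R a i\<close>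
  with \<open>c k i\<close> tending to 1. Their maximal norm is a maximum over finitely many
  generators and tends to the positive number \<open>R'\<close>, hence the normalised generators
  converge.\<close>

lemma normalized_hull_tendsto:
  fixes a :: "'i \<Rightarrow> 'a::euclidean_space"
  assumes I: "finite I" "I \<noteq> {}" and nz: "\<And>i. i \<in> I \<Longrightarrow> a i \<noteq> 0"
    and P: "\<And>k. 1 \<le> k \<Longrightarrow> P k = convex hull ((\<lambda>i. s k i *\<^sub>R a i) ` I)"
    and lim: "\<And>i. i \<in> I \<Longrightarrow> (\<lambda>k. real k powr \<beta> * s k i) \<longlonglongrightarrow> 1"
  shows "(\<lambda>k. hausdorff_distance ((\<lambda>x. x /\<^sub>R max_norm (P k)) ` P k)
    ((\<lambda>x. x /\<^sub>R max_norm (convex hull (a ` I))) ` (convex hull (a ` I)))) \<longlonglongrightarrow> 0"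
proof -
  define c where "c k i = real k powr \<beta> * s k i" for k i
  define R where "R k = Max ((\<lambda>i. norm (c k i *\<^sub>R a i)) ` I)" for k
  define R' where "R' = Max ((\<lambda>i. norm (a i)) ` I)"
  have c: "(\<lambda>k. c k i) \<longlonglongrightarrow> 1" if "i \<in> I" for i using lim[OF that] by (simp add: c_def)
  have "(\<lambda>k. norm (c k i *\<^sub>R a i)) \<longlonglongrightarrow> norm (1 *\<^sub>R a i)" if "i \<in> I" for i
    by (intro tendsto_intros c that)
  then have R: "R \<longlonglongrightarrow> R'"
    unfolding R_def R'_def using I by (intro tendsto_Max_image) auto
  have "0 < R'" unfolding R'_def using I nz by (subst Max_gr_iff) auto
  have max_a: "max_norm (convex hull (a ` I)) = R'"
    unfolding R'_def by (rule max_norm_convex_hull_image[OF I])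
  have norm_P: "(\<lambda>x. x /\<^sub>R max_norm (P k)) ` P k = convex hull ((\<lambda>i. (c k i / R k) *\<^sub>R a i) ` I)"
    if k: "1 \<le> k" for k
  proof -
    define q where "q = Max ((\<lambda>i. norm (s k i *\<^sub>R a i)) ` I)"
    have "max_norm (P k) = q"
      unfolding P[OF k] q_def by (rule max_norm_convex_hull_image[OF I])
    then have "(\<lambda>x. x /\<^sub>R max_norm (P k)) ` P k = (*\<^sub>R) (inverse q) ` (convex hull ((\<lambda>i. s k i *\<^sub>R a i) ` I))"
      using P[OF k] by simp
    also have "\<dots> = convex hull ((\<lambda>i. (s k i / q) *\<^sub>R a i) ` I)"
      by (simp add: convex_hull_scaling[symmetric] image_image divide_inverse mult.commute)
    finally have "(\<lambda>x. x /\<^sub>R max_norm (P k)) ` P k = convex hull ((\<lambda>i. (s k i / q) *\<^sub>R a i) ` I)" .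
    moreover have "s k i / q = c k i / R k" for i
    proof -
      have kp: "0 < real k powr \<beta>" using k by simp
      have "R k = real k powr \<beta> * q"
      proof -
        have "real k powr \<beta> * q = Max ((*) (real k powr \<beta>) ` (\<lambda>i. norm (s k i *\<^sub>R a i)) ` I)"
          unfolding q_def using I kp by (intro mono_Max_commute monoI mult_left_mono) auto
        also have "\<dots> = R k"
          using kp by (simp add: R_def c_def image_image abs_mult mult.assoc)
        finally show ?thesis by simp
      qed
      then show ?thesis using kp by (simp add: c_def)
    qed
    ultimately show ?thesis by simp
  qed
  have norm_a: "(\<lambda>x. x /\<^sub>R max_norm (convex hull (a ` I))) ` (convex hull (a ` I))
      = convex hull ((\<lambda>i. (1 / R') *\<^sub>R a i) ` I)"
    by (simp add: max_a convex_hull_scaling[symmetric] image_image divide_inverse)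
  have "(\<lambda>k. norm ((c k i / R k) *\<^sub>R a i - (1 / R') *\<^sub>R a i)) \<longlonglongrightarrow> norm ((1 / R') *\<^sub>R a i - (1 / R') *\<^sub>R a i)"
    if "i \<in> I" for i
    using \<open>0 < R'\<close> by (intro tendsto_intros c R that) auto
  then have "(\<lambda>k. \<Sum>i\<in>I. norm ((c k i / R k) *\<^sub>R a i - (1 / R') *\<^sub>R a i)) \<longlonglongrightarrow> 0"
    by (intro tendsto_null_sum) auto
  then show ?thesis
  proof (rule Lim_null_comparison[rotated])
    show "\<forall>\<^sub>F k in sequentially. norm (hausdorff_distance ((\<lambda>x. x /\<^sub>R max_norm (P k)) ` P k)
        ((\<lambda>x. x /\<^sub>R max_norm (convex hull (a ` I))) ` (convex hull (a ` I))))
      \<le> (\<Sum>i\<in>I. norm ((c k i / R k) *\<^sub>R a i - (1 / R') *\<^sub>R a i))"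
      using eventually_ge_at_top[of 1]
    proof eventually_elim
      case (elim k)
      let ?b = "\<lambda>i. (c k i / R k) *\<^sub>R a i" and ?d = "\<lambda>i. (1 / R') *\<^sub>R a i"
      have "hausdorff_distance (convex hull (?b ` I)) (convex hull (?d ` I)) \<le> (\<Sum>i\<in>I. norm (?b i - ?d i))"
        using I by (intro hausdorff_distance_convex_hull_image member_le_sum) auto
      moreover have "0 \<le> hausdorff_distance (convex hull (?b ` I)) (convex hull (?d ` I))"
        using I by (intro hausdorff_distance_nonneg) (auto intro: finite_imp_compact_convex_hull)
      ultimately show ?case unfolding norm_P[OF elim] norm_a by simp
    qed
  qed
qed

section \<open>Peeling points on finitely many rays\<close>

text \<open>The negative of the sum of all \<open>e i\<close> is itself a nonnegative combination of
  them. Adding the sum back represents 0 with the strictly positive coefficients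
  \<open>1 + b i\<close>; dividing these by \<open>s i\<close> and normalising gives the convex
  combination of the rescaled vectors.\<close>

lemma zero_in_convex_hull_of_cone:
  fixes e :: "'i \<Rightarrow> 'a::real_vector"
  assumes I: "finite I" "I \<noteq> {}" "inj_on e I" and cone: "convex_cone hull (e ` I) = UNIV"
    and s: "\<And>i. i \<in> I \<Longrightarrow> 0 < s i"
  shows "0 \<in> convex hull ((\<lambda>i. s i *\<^sub>R e i) ` I)"
proof -
  have "- (\<Sum>i\<in>I. e i) \<in> convex_cone hull (e ` I)" using cone by simp
  then obtain F c where F: "- (\<Sum>i\<in>I. e i) = (\<Sum>x\<in>F. c x *\<^sub>R x)" "F \<subseteq> e ` I"
    and c: "\<forall>x\<in>F. 0 \<le> c x"
    unfolding convex_cone_hull_explicit by blast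
  define b where "b i = (if e i \<in> F then c (e i) else 0)" for i
  have b: "0 \<le> b i" for i using c by (auto simp: b_def)
  have "(\<Sum>x\<in>F. c x *\<^sub>R x) = (\<Sum>x\<in>e ` I. (if x \<in> F then c x else 0) *\<^sub>R x)"
    using F(2) I(1) by (intro sum.mono_neutral_cong_left) auto
  also have "\<dots> = (\<Sum>i\<in>I. b i *\<^sub>R e i)"
    using I(3) by (simp add: sum.reindex b_def)
  finally have "(\<Sum>i\<in>I. b i *\<^sub>R e i) = - (\<Sum>i\<in>I. e i)" using F(1) by simp
  then have zero: "(\<Sum>i\<in>I. (1 + b i) *\<^sub>R e i) = 0"
    by (simp only: scaleR_add_left sum.distrib scaleR_one right_minus)
  define w where "w i = (1 + b i) / s i" for i
  have w: "0 < w i" if "i \<in> I" for i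
    unfolding w_def using s[OF that] b[of i] by (simp add: add_pos_nonneg)
  have W: "0 < sum w I" using I w by (intro sum_pos) auto
  have "(\<Sum>i\<in>I. (w i / sum w I) *\<^sub>R (s i *\<^sub>R e i)) \<in> convex hull ((\<lambda>i. s i *\<^sub>R e i) ` I)"
    using w W I by (intro convex_sum) (auto simp: less_imp_le intro: hull_inc simp flip: sum_divide_distrib)
  moreover have "(\<Sum>i\<in>I. (w i / sum w I) *\<^sub>R (s i *\<^sub>R e i)) = (\<Sum>i\<in>I. (1 / sum w I) *\<^sub>R ((1 + b i) *\<^sub>R e i))"
    using s by (intro sum.cong) (auto simp: w_def less_imp_neq[symmetric])
  also have "\<dots> = 0" by (simp only: zero scaleR_sum_right[symmetric] scaleR_zero_right)
  finally show ?thesis by simp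
qed

text \<open>Deleting an extreme point from the hull leaves a convex set, which contains 0 and the
  other generators. So \<open>a i\<close> avoids the compact set \<open>K i\<close>, and so does
  \<open>a i\<close> shrunk by 1 / (1 + \<epsilon>), with one \<epsilon> for the finitely many
  \<open>i\<close>. Scaling by \<open>c\<close> carries the other points into the segments from 0 to
  \<open>a j\<close>, inside \<open>K i\<close>, but the point on ray \<open>i\<close> to the shrunk
  \<open>a i\<close>.\<close>

lemma extreme_slack:
  fixes a :: "'i \<Rightarrow> 'a::euclidean_space"
  assumes I: "finite I" "inj_on a I" and ext: "ext (convex hull (a ` I)) = a ` I"
    and zero: "0 \<in> convex hull (a ` I)" and nz: "\<And>i. i \<in> I \<Longrightarrow> a i \<noteq> 0"
  shows "\<exists>\<epsilon>>0. \<forall>i\<in>I. \<forall>s. (\<forall>j\<in>I. 0 < s j \<and> s j \<le> (1 + \<epsilon>) * s i) \<longrightarrow>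
           s i *\<^sub>R a i \<notin> convex hull ((\<lambda>j. s j *\<^sub>R a j) ` (I - {i}))"
proof -
  define K where "K i = convex hull (insert 0 (a ` (I - {i})))" for i
  have a_K: "a i \<notin> K i" if i: "i \<in> I" for i
  proof -
    have "a i extreme_point_of convex hull (a ` I)" using ext i by (auto simp: ext_def)
    then have "convex (convex hull (a ` I) - {a i})" by (simp add: extreme_point_of_stillconvex)
    moreover have "insert 0 (a ` (I - {i})) \<subseteq> convex hull (a ` I) - {a i}"
      using zero nz[OF i] I(2) i by (auto intro: hull_inc dest: inj_onD)
    ultimately have "K i \<subseteq> convex hull (a ` I) - {a i}"
      unfolding K_def by (intro hull_minimal)
    then show ?thesis by auto
  qed
  have "\<forall>\<^sub>F \<epsilon> in at_right 0. \<forall>i\<in>I. (1 / (1 + \<epsilon>)) *\<^sub>R a i \<in> - K i"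
  proof (rule eventually_ball_finite[OF I(1)], rule ballI)
    fix i assume i: "i \<in> I"
    have "((\<lambda>\<epsilon>. (1 / (1 + \<epsilon>)) *\<^sub>R a i) \<longlongrightarrow> (1 / (1 + 0)) *\<^sub>R a i) (at_right 0)"
      by (intro tendsto_intros) auto
    moreover have "open (- K i)"
      unfolding K_def using I(1) by (intro open_Compl compact_imp_closed finite_imp_compact_convex_hull) auto
    ultimately show "\<forall>\<^sub>F \<epsilon> in at_right 0. (1 / (1 + \<epsilon>)) *\<^sub>R a i \<in> - K i"
      using a_K[OF i] by (intro topological_tendstoD) auto
  qed
  moreover have "\<forall>\<^sub>F \<epsilon>::real in at_right 0. 0 < \<epsilon>" by (rule eventually_at_right_less)
  ultimately have "\<forall>\<^sub>F \<epsilon> in at_right 0. 0 < \<epsilon> \<and> (\<forall>i\<in>I. (1 / (1 + \<epsilon>)) *\<^sub>R a i \<in> - K i)"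
    by (intro eventually_conj)
  then have "\<exists>\<epsilon>. 0 < \<epsilon> \<and> (\<forall>i\<in>I. (1 / (1 + \<epsilon>)) *\<^sub>R a i \<in> - K i)"
    by (rule eventually_happens'[OF trivial_limit_at_right_real])
  then obtain \<epsilon> :: real where \<epsilon>: "0 < \<epsilon>" "\<And>i. i \<in> I \<Longrightarrow> (1 / (1 + \<epsilon>)) *\<^sub>R a i \<notin> K i"
    by blast
  show ?thesis
  proof (intro exI[of _ \<epsilon>] conjI ballI allI impI notI)
    fix i s assume i: "i \<in> I" and s: "\<forall>j\<in>I. 0 < s j \<and> s j \<le> (1 + \<epsilon>) * s i"
      and hull: "s i *\<^sub>R a i \<in> convex hull ((\<lambda>j. s j *\<^sub>R a j) ` (I - {i}))"
    define c where "c = 1 / ((1 + \<epsilon>) * s i)"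
    have c: "0 < c" using s i \<epsilon>(1) by (simp add: c_def)
    have "c *\<^sub>R (s i *\<^sub>R a i) \<in> convex hull ((*\<^sub>R) c ` (\<lambda>j. s j *\<^sub>R a j) ` (I - {i}))"
      using hull unfolding convex_hull_scaling by blast
    also have "\<dots> \<subseteq> K i"
    proof (rule hull_minimal)
      have "c *\<^sub>R (s j *\<^sub>R a j) \<in> K i" if j: "j \<in> I - {i}" for j
      proof -
        have cs: "0 \<le> c * s j" "c * s j \<le> 1"
          using s j i c \<epsilon>(1) by (auto simp: c_def divide_le_eq less_imp_le)
        have "(1 - c * s j) *\<^sub>R 0 + (c * s j) *\<^sub>R a j \<in> K i"
          unfolding K_def using j cs by (intro convexD) (auto intro: hull_inc)
        then show ?thesis by simp
      qed
      then show "(*\<^sub>R) c ` (\<lambda>j. s j *\<^sub>R a j) ` (I - {i}) \<subseteq> K i"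
        unfolding image_image by (rule image_subsetI)
    qed (simp add: K_def)
    finally have "(1 / (1 + \<epsilon>)) *\<^sub>R a i \<in> K i"
      using s i \<epsilon>(1) by (auto simp: c_def dest: less_imp_neq)
    then show False using \<epsilon>(2) i by blast
  qed (rule \<epsilon>(1))
qed

section \<open>Deterministic peeling of decreasing sequences on rays\<close>

text \<open>\<open>zero_in_hull\<close> is asked for all positive weights because the outermost
  points change from round to round.\<close>

locale ray_peeling =
  fixes I :: "'i set" and a :: "'i \<Rightarrow> 'a::euclidean_space" and r :: "'i \<Rightarrow> nat \<Rightarrow> real"
  assumes finite_I: "finite I" and I_nonempty: "I \<noteq> {}"
    and distinct_rays: "\<lbrakk>i \<in> I; j \<in> I; i \<noteq> j; 0 < s; 0 < t\<rbrakk> \<Longrightarrow> s *\<^sub>R a i \<noteq> t *\<^sub>R a j"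
    and a_nonzero: "i \<in> I \<Longrightarrow> a i \<noteq> 0"
    and zero_in_hull: "(\<And>i. i \<in> I \<Longrightarrow> 0 < w i) \<Longrightarrow> 0 \<in> convex hull ((\<lambda>i. w i *\<^sub>R a i) ` I)"
    and r_pos: "i \<in> I \<Longrightarrow> 0 < r i p"
    and r_decreasing: "\<lbrakk>i \<in> I; p < q\<rbrakk> \<Longrightarrow> r i q < r i p"
begin

text \<open>The vector \<open>n\<close> of the numbers of points already lost by the rays encodes
  the whole state of the peeling.\<close>

definition rest :: "('i \<Rightarrow> nat) \<Rightarrow> 'a set" where
  "rest n = {r i j *\<^sub>R a i | i j. i \<in> I \<and> n i \<le> j}"

definition tops :: "('i \<Rightarrow> nat) \<Rightarrow> 'a set" where
  "tops n = (\<lambda>i. r i (n i) *\<^sub>R a i) ` I"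

definition step :: "('i \<Rightarrow> nat) \<Rightarrow> 'i \<Rightarrow> nat" where
  "step n i = n i + of_bool (r i (n i) *\<^sub>R a i \<in> ext (convex hull tops n))"

definition removed :: "nat \<Rightarrow> 'i \<Rightarrow> nat" where
  "removed k = (step ^^ k) (\<lambda>_. 0)"

lemma removed_0 [simp]: "removed 0 i = 0"
  and removed_Suc: "removed (Suc k) = step (removed k)"
  by (simp_all add: removed_def)

lemma r_mono: "\<lbrakk>i \<in> I; j \<le> k\<rbrakk> \<Longrightarrow> r i k \<le> r i j"
  using r_decreasing[of i j k] by (cases "j = k") auto

lemma r_inj: "\<lbrakk>i \<in> I; j \<in> I\<rbrakk> \<Longrightarrow> r i p *\<^sub>R a i = r j q *\<^sub>R a j \<longleftrightarrow> i = j \<and> p = q"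
  using distinct_rays[of i j "r i p" "r j q"] r_pos a_nonzero r_decreasing[of i p q]
    r_decreasing[of i q p] by (cases "i = j"; cases p q rule: linorder_cases) auto

text \<open>A deeper point lies on the segment from 0 to the outermost point of its ray, and 0 lies
  in the hull of the outermost points. So finitely many points span the hull of an infinite
  set.\<close>

lemma convex_hull_rest: "convex hull rest n = convex hull tops n"
proof (rule antisym; rule hull_minimal)
  show "rest n \<subseteq> convex hull tops n"
  proof
    fix x assume "x \<in> rest n"
    then obtain i j where x: "x = r i j *\<^sub>R a i" "i \<in> I" "n i \<le> j" by (auto simp: rest_def)
    let ?t = "r i j / r i (n i)"
    have t: "0 \<le> ?t" "?t \<le> 1" using x r_mono[of i "n i" j] r_pos[of i] by (auto simp: less_imp_le)
    have "0 \<in> convex hull tops n"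
      unfolding tops_def by (rule zero_in_hull) (rule r_pos)
    moreover have "r i (n i) *\<^sub>R a i \<in> convex hull tops n"
      using x by (auto simp: tops_def intro!: hull_inc)
    ultimately have "(1 - ?t) *\<^sub>R 0 + ?t *\<^sub>R (r i (n i) *\<^sub>R a i) \<in> convex hull tops n"
      using t by (intro convexD) auto
    then show "x \<in> convex hull tops n" using x r_pos[of i "n i"] by simp
  qed
  show "tops n \<subseteq> convex hull rest n"
    by (auto simp: tops_def rest_def intro!: hull_inc)
qed simp_all

text \<open>Extreme points of the hull of \<open>tops n\<close> belong to \<open>tops n\<close>, and
  by \<open>r_inj\<close> the only candidate on ray \<open>i\<close> is the point with index
  \<open>n i\<close>.\<close>

lemma rest_step: "rest n - ext (convex hull rest n) = rest (step n)"
proof -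
  have sub: "ext (convex hull tops n) \<subseteq> tops n"
    unfolding ext_def by (rule extreme_points_of_convex_hull)
  have "r i j *\<^sub>R a i \<in> ext (convex hull tops n) \<longleftrightarrow> \<not> step n i \<le> j" if "i \<in> I" "n i \<le> j" for i j
  proof (cases "j = n i")
    case True
    then show ?thesis by (simp add: step_def)
  next
    case False
    then have "r i j *\<^sub>R a i \<notin> tops n" using that by (auto simp: tops_def r_inj)
    then show ?thesis using sub that False by (auto simp: step_def)
  qed
  moreover have "n i \<le> step n i" for i by (simp add: step_def)
  ultimately show ?thesis
    unfolding convex_hull_rest
  proof (intro equalityI subsetI)
    assume *: "\<And>i j. \<lbrakk>i \<in> I; n i \<le> j\<rbrakk> \<Longrightarrow> r i j *\<^sub>R a i \<in> ext (convex hull tops n) \<longleftrightarrow> \<not> step n i \<le> j"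
    show "x \<in> rest (step n)" if "x \<in> rest n - ext (convex hull tops n)" for x
      using that * unfolding rest_def by blast
    assume le: "\<And>i. n i \<le> step n i"
    fix x assume "x \<in> rest (step n)"
    then obtain i j where x: "x = r i j *\<^sub>R a i" "i \<in> I" "step n i \<le> j" by (auto simp: rest_def)
    moreover from this have "n i \<le> j" using le[of i] by linarith
    ultimately show "x \<in> rest n - ext (convex hull tops n)"
      using *[of i j] by (auto simp: rest_def)
  qed 
qed

text \<open>Rounds are numbered from 1, so exactly \<open>k\<close> rounds have been carried out
  before round \<open>Suc k\<close>.\<close>

lemma peel_points_eq_rest: "peel_points (rest (\<lambda>_. 0)) (Suc k) = rest (removed k)"
proof (induction k)
  case 0
  then show ?case by (simp add: removed_def)
next
  case (Suc k)
  then show ?case by (simp add: removed_Suc rest_step)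
qed

lemma peel_hull_eq: "peel_hull (rest (\<lambda>_. 0)) (Suc k) = convex hull tops (removed k)"
  by (simp only: peel_hull_def peel_points_eq_rest convex_hull_rest)

lemma step_eq_Suc:
  assumes "i \<in> I" "r i (n i) *\<^sub>R a i \<notin> convex hull ((\<lambda>j. r j (n j) *\<^sub>R a j) ` (I - {i}))"
  shows "step n i = Suc (n i)"
proof -
  have "tops n = insert (r i (n i) *\<^sub>R a i) ((\<lambda>j. r j (n j) *\<^sub>R a j) ` (I - {i}))"
    using assms(1) by (auto simp: tops_def)
  then show ?thesis
    unfolding step_def ext_def
    using extreme_point_of_convex_hull_insert[OF _ assms(2)] finite_I by simp
qed

text \<open>Expanding the squared distance of two distinct points shows
  \<open>?p \<bullet> ?q < ?p \<bullet> ?p\<close> when \<open>?q\<close> is not longer than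
  \<open>?p\<close>. So an open half-space contains all other outermost points but not
  \<open>?p\<close>. This works for any radii and hence covers the early rounds.\<close>

lemma step_max_norm:
  assumes i: "i \<in> I" and max: "\<And>j. j \<in> I \<Longrightarrow> norm (r j (n j) *\<^sub>R a j) \<le> norm (r i (n i) *\<^sub>R a i)"
  shows "step n i = Suc (n i)"
proof (rule step_eq_Suc[OF i])
  let ?p = "r i (n i) *\<^sub>R a i"
  have "convex hull ((\<lambda>j. r j (n j) *\<^sub>R a j) ` (I - {i})) \<subseteq> {x. ?p \<bullet> x < ?p \<bullet> ?p}"
  proof (intro hull_minimal convex_halfspace_lt image_subsetI CollectI)
    fix j assume j: "j \<in> I - {i}"
    let ?q = "r j (n j) *\<^sub>R a j"
    have "?p \<noteq> ?q" using i j by (auto simp: r_inj)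
    then have "0 < (?p - ?q) \<bullet> (?p - ?q)" by (simp only: inner_gt_zero_iff right_minus_eq) simp
    moreover have "?q \<bullet> ?q \<le> ?p \<bullet> ?p" using max[of j] j by (simp only: norm_le Diff_iff)
    ultimately show "?p \<bullet> ?q < ?p \<bullet> ?p" by (simp only: inner_diff inner_commute[of ?q ?p])
  qed
  then show "?p \<notin> convex hull ((\<lambda>j. r j (n j) *\<^sub>R a j) ` (I - {i}))" by auto
qed

lemma removed_mono: "k \<le> m \<Longrightarrow> removed k i \<le> removed m i"
  by (induction rule: dec_induct) (auto simp: removed_Suc step_def)

lemma removed_le: "removed k i \<le> k"
  by (induction k) (auto simp: removed_Suc step_def)

text \<open>A stuck ray would keep an outermost point of norm at least \<open>\<delta>\<close>. Only
  finitely many points are that long, yet each round would use up one of them. \<open>\<Phi>\<close>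
  counts the removals below the indices \<open>J\<close>, from which on all norms are less than
  \<open>\<delta>\<close>; it would be bounded and grow in every round.\<close>

lemma removed_unbounded:
  assumes lim: "\<And>i. i \<in> I \<Longrightarrow> r i \<longlonglongrightarrow> 0" and i: "i \<in> I"
  shows "\<exists>k. c \<le> removed k i"
proof (rule ccontr)
  assume "\<not> ?thesis"
  then have c: "removed k i < c" for k by (simp add: not_le)
  define \<delta> where "\<delta> = norm (r i c *\<^sub>R a i)"
  have "0 < \<delta>" using i r_pos[of i c] a_nonzero by (simp add: \<delta>_def)
  have "\<exists>J. norm (r j J *\<^sub>R a j) < \<delta>" if "j \<in> I" for j
  proof -
    have "(\<lambda>J. norm (r j J *\<^sub>R a j)) \<longlonglongrightarrow> norm (0 *\<^sub>R a j)"
      by (intro tendsto_intros lim that)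
    then have "eventually (\<lambda>J. norm (r j J *\<^sub>R a j) < \<delta>) sequentially"
      using \<open>0 < \<delta>\<close> by (intro order_tendstoD(2)) auto
    then show ?thesis by (auto simp: eventually_sequentially)
  qed
  then obtain J where J: "\<And>j. j \<in> I \<Longrightarrow> norm (r j (J j) *\<^sub>R a j) < \<delta>" by metis
  \<comment> \<open>The point of largest norm is removed in every round, and its norm stays above \<open>\<delta>\<close>.\<close>
  define \<Phi> where "\<Phi> k = (\<Sum>j\<in>I. min (removed k j) (J j))" for k
  have "\<Phi> k < \<Phi> (Suc k)" for k
  proof -
    let ?N = "\<lambda>j. norm (r j (removed k j) *\<^sub>R a j)"
    have "Max (?N ` I) \<in> ?N ` I" using finite_I I_nonempty by (intro Max_in) auto
    then obtain j where j: "j \<in> I" "Max (?N ` I) = ?N j" by auto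
    then have max: "?N j' \<le> ?N j" if "j' \<in> I" for j'
      using finite_I that Max_ge[of "?N ` I" "?N j'"] by auto
    have "removed (Suc k) j = Suc (removed k j)"
      unfolding removed_Suc by (rule step_max_norm[OF j(1) max])
    moreover have "removed k j < J j"
    proof (rule ccontr)
      assume "\<not> ?thesis"
      then have "?N j \<le> norm (r j (J j) *\<^sub>R a j)"
        using r_mono[of j "J j" "removed k j"] r_pos[of j] j(1)
        by (auto intro!: mult_right_mono simp: less_imp_le abs_of_pos)
      moreover have "\<delta> \<le> ?N i"
        using r_mono[OF i, of "removed k i" c] c[of k] r_pos[OF i]
        by (auto intro!: mult_right_mono simp: less_imp_le abs_of_pos \<delta>_def)
      ultimately show False using J[OF j(1)] max[OF i] by linarith
    qed
    ultimately have "min (removed k j) (J j) < min (removed (Suc k) j) (J j)" by simp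
    moreover have "min (removed k j') (J j') \<le> min (removed (Suc k) j') (J j')" for j'
      using removed_mono[of k "Suc k" j'] by simp
    ultimately show ?thesis
      unfolding \<Phi>_def using finite_I j(1) by (intro sum_strict_mono_ex1) auto
  qed
  then have "k \<le> \<Phi> k" for k by (induction k) (auto simp: Suc_le_eq intro: le_less_trans)
  moreover have "\<Phi> k \<le> (\<Sum>j\<in>I. J j)" for k unfolding \<Phi>_def by (intro sum_mono) simp
  ultimately have "Suc (\<Sum>j\<in>I. J j) \<le> (\<Sum>j\<in>I. J j)" by (meson order_trans)
  then show False by simp
qed

text \<open>The induction follows only the minimum: a ray exactly at the bound \<open>N + k\<close>
  is a minimal one and advances by \<open>adv\<close>, and any other ray already satisfies the next
  bound. The constant pays for the rounds until every ray has lost \<open>N\<close> points.\<close>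

lemma removed_ge:
  assumes lim: "\<And>i. i \<in> I \<Longrightarrow> r i \<longlonglongrightarrow> 0"
    and adv: "\<And>n i. \<lbrakk>i \<in> I; \<And>j. j \<in> I \<Longrightarrow> N \<le> n j \<and> n i \<le> n j\<rbrakk> \<Longrightarrow> step n i = Suc (n i)"
  shows "\<exists>c. \<forall>k. \<forall>i\<in>I. k \<le> removed k i + c"
proof -
  have "\<forall>i\<in>I. \<exists>k. N \<le> removed k i" using removed_unbounded lim by blast
  then obtain K where K: "\<And>i. i \<in> I \<Longrightarrow> N \<le> removed (K i) i" by metis
  define c where "c = Max (K ` I)"
  have base: "N \<le> removed c i" if "i \<in> I" for i
    using K[OF that] removed_mono[of "K i" c i] finite_I that by (force simp: c_def)
  have "\<forall>i\<in>I. N + k \<le> removed (c + k) i" for k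
  proof (induction k)
    case 0
    then show ?case using base by simp
  next
    case (Suc k)
    show ?case
    proof
      fix i assume i: "i \<in> I"
      show "N + Suc k \<le> removed (c + Suc k) i"
      proof (cases "removed (c + k) i = N + k")
        case True
        then have "removed (Suc (c + k)) i = Suc (removed (c + k) i)"
          unfolding removed_Suc using Suc i by (intro adv) (auto intro: add_leD1)
        then show ?thesis using True by simp
      next
        case False
        then have "N + Suc k \<le> removed (c + k) i" using Suc i by (force simp: le_less)
        then show ?thesis using removed_mono[of "c + k" "c + Suc k" i] by simp
      qed
    qed
  qed
  then have ge: "k \<le> removed (c + k) i" if "i \<in> I" for k i
    using that by (meson add_leD2)
  have "k \<le> removed k i + c" if "i \<in> I" for k i
  proof (cases "k \<le> c")
    case False
    then have "c + (k - c) = k" by simp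
    then show ?thesis using ge[OF that, of "k - c"] by simp
  qed simp
  then show ?thesis by blast
qed

end

section \<open>The rate of the law of the iterated logarithm\<close>

text \<open>The normalisation in the law of the iterated logarithm, up to the factor sqrt 2. Below
  exp 1 the iterated logarithm is not nonnegative; this is the reason for the thresholds 3 in what
  follows.\<close>

definition lil :: "real \<Rightarrow> real" where
  "lil t = sqrt (t * ln (ln t))"

lemma ln_ln_nonneg:
  fixes t :: real
  assumes "3 \<le> t"
  shows "0 \<le> ln (ln t)"
proof -
  have "1 \<le> ln t" using assms exp_le by (subst ln_ge_iff) auto
  then show ?thesis by simp
qed

lemma lil_nonneg: "3 \<le> t \<Longrightarrow> 0 \<le> lil t"
  unfolding lil_def using ln_ln_nonneg[of t] by simp

lemma lil_mono:
  assumes "3 \<le> s" "s \<le> t"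
  shows "lil s \<le> lil t"
proof -
  have "1 \<le> ln s" using assms exp_le by (subst ln_ge_iff) auto
  then have "ln (ln s) \<le> ln (ln t)" using assms by simp
  then show ?thesis
    unfolding lil_def using assms ln_ln_nonneg[of s] by (intro real_sqrt_le_mono mult_mono) auto
qed

lemma lil_ge_1: "\<forall>\<^sub>F t in at_top. 1 \<le> lil t"
  and lil_triple: "\<forall>\<^sub>F t in at_top. lil (3 * t) \<le> 2 * lil t"
  and lil_div_tendsto_0: "((\<lambda>t. lil t / t) \<longlongrightarrow> 0) at_top"
  and lil_div: "\<forall>\<^sub>F t in at_top. lil t / t = sqrt (ln (ln t) / t)"
  subgoal unfolding lil_def by real_asymp
  subgoal
  proof -
    \<comment> \<open>The ratio tends to 1, and 4 / 3 is the room available, as 3 * (4 / 3) =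
      2^2.\<close>
    have "((\<lambda>t::real. ln (ln (3 * t)) / ln (ln t)) \<longlongrightarrow> 1) at_top" by real_asymp
    then have "\<forall>\<^sub>F t::real in at_top. ln (ln (3 * t)) / ln (ln t) < 4 / 3"
      by (rule order_tendstoD) simp
    moreover have "\<forall>\<^sub>F t::real in at_top. 0 < ln (ln t)" by real_asymp
    ultimately show ?thesis
      using eventually_gt_at_top[of 0]
    proof eventually_elim
      case (elim t)
      then have "3 * t * ln (ln (3 * t)) \<le> 4 * (t * ln (ln t))"
        by (simp add: divide_less_eq)
      then have "lil (3 * t) \<le> sqrt (4 * (t * ln (ln t)))"
        unfolding lil_def by (rule real_sqrt_le_mono)
      also have "\<dots> = 2 * lil t" by (simp add: lil_def real_sqrt_mult)
      finally show ?case .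
    qed
  qed
  subgoal unfolding lil_def by real_asymp
  subgoal unfolding lil_def
    using eventually_gt_at_top[of 3]
  proof eventually_elim
    case (elim t)
    have "sqrt (t * ln (ln t)) / t = sqrt (t * ln (ln t)) / sqrt (t\<^sup>2)" using elim by simp
    also have "\<dots> = sqrt (t * ln (ln t) / t\<^sup>2)" by (simp only: real_sqrt_divide)
    also have "t * ln (ln t) / t\<^sup>2 = ln (ln t) / t" by (simp add: power2_eq_square)
    finally show ?case .
  qed
  done

text \<open>The left-hand side is the bound of \<open>AE_dyadic_maxima\<close> at the first dyadic
  level 2^p above t, where 2^p \<le> 2 t and p \<le> log 2 t + 1. Once the logarithms have ratio
  below 2, the radicand is at most 32 t ln (ln t) \<le> 36 t ln (ln t). Hence the constant 12 = 2 *
  6.\<close>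

lemma dyadic_bound_lil:
  "\<forall>\<^sub>F t in at_top. 2 * sqrt (8 * (2 * t) * ln (log 2 t + 1)) \<le> 12 * lil t"
proof -
  have "((\<lambda>t::real. ln (log 2 t + 1) / ln (ln t)) \<longlongrightarrow> 1) at_top" by real_asymp
  then have "\<forall>\<^sub>F t::real in at_top. ln (log 2 t + 1) / ln (ln t) < 2" by (rule order_tendstoD) simp
  moreover have "\<forall>\<^sub>F t::real in at_top. 0 < ln (ln t)" by real_asymp
  ultimately show ?thesis
    using eventually_gt_at_top[of 0]
  proof eventually_elim
    case (elim t)
    have "ln (log 2 t + 1) \<le> 2 * ln (ln t)" using elim by (simp add: divide_less_eq)
    then have "16 * t * ln (log 2 t + 1) \<le> 16 * t * (2 * ln (ln t))" using elim by (intro mult_left_mono) auto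
    also have "\<dots> \<le> 36 * (t * ln (ln t))" using elim by simp
    finally have "sqrt (8 * (2 * t) * ln (log 2 t + 1)) \<le> sqrt (36 * (t * ln (ln t)))" by simp
    also have "\<dots> = 6 * lil t" by (simp add: lil_def real_sqrt_mult)
    finally show ?case by simp
  qed
qed

section \<open>From counting functions to enumerated points\<close>

text \<open>With t the integer part of \<open>u j\<close>, the counts at t and t + 1 enclose j + 1
  (indices start at 0). The deviation bound at these two integers therefore encloses
  \<open>u j\<close>; the rounding costs at most 2, which is absorbed because \<open>lil\<close> is
  eventually at least 1.\<close>

lemma lil_inversion:
  assumes u: "strict_mono u" "\<And>j. 0 \<le> u j" and fin: "\<And>t. finite {j. u j \<le> t}"
    and N: "\<And>t. K \<le> t \<Longrightarrow> \<bar>real (card {j. u j \<le> real t}) - real t\<bar> \<le> m * lil (real t)"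
  shows "\<exists>m. \<forall>\<^sub>F j in sequentially. \<bar>u j - real j\<bar> \<le> m * lil (real j)"
proof -
  define t where "t j = nat \<lfloor>u j\<rfloor>" for j
  have t: "real (t j) \<le> u j" "u j < real (t j) + 1" for j
    using u(2)[of j] by (auto simp: t_def)
  have u_le: "u i \<le> u j \<longleftrightarrow> i \<le> j" for i j using u(1) by (simp add: strict_mono_less_eq)
  have N_le: "card {i. u i \<le> real (t j)} \<le> Suc j" for j
  proof -
    have "{i. u i \<le> real (t j)} \<subseteq> {..j}" using t(1)[of j] u_le order_trans by blast
    then show ?thesis using card_mono[of "{..j}"] by fastforce
  qed
  have N_ge: "Suc j \<le> card {i. u i \<le> real (Suc (t j))}" for j
  proof -
    have "{..j} \<subseteq> {i. u i \<le> real (Suc (t j))}"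
    proof
      fix i assume "i \<in> {..j}"
      then have "u i \<le> u j" by (simp add: u_le)
      then show "i \<in> {i. u i \<le> real (Suc (t j))}" using t(2)[of j] by simp
    qed
    then show ?thesis using card_mono[OF fin, of "{..j}"] by fastforce
  qed
  have "filterlim u at_top sequentially"
    unfolding filterlim_at_top
  proof
    fix Z
    have "finite {j. u j < Z}" by (rule finite_subset[OF _ fin[of Z]]) auto
    then have "\<forall>\<^sub>F j in cofinite. \<not> u j < Z" by (simp add: eventually_cofinite)
    then show "\<forall>\<^sub>F j in sequentially. Z \<le> u j" by (simp add: cofinite_eq_sequentially not_less)
  qed
  moreover have "filterlim (\<lambda>x::real. nat \<lfloor>x\<rfloor>) at_top at_top" by real_asymp
  ultimately have t_top: "filterlim t at_top sequentially"
    unfolding t_def by (rule filterlim_compose[rotated])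
  have "((\<lambda>t. \<bar>m\<bar> * (lil t / t)) \<longlongrightarrow> \<bar>m\<bar> * 0) at_top" by (intro tendsto_intros lil_div_tendsto_0)
  then have "\<forall>\<^sub>F t in at_top. \<bar>m\<bar> * (lil t / t) < 1 / 2" by (rule order_tendstoD) simp
  then have "\<forall>\<^sub>F t in at_top. \<bar>m\<bar> * lil t \<le> t / 2"
    using eventually_gt_at_top[of 0] by eventually_elim (simp add: field_simps)
  then have small: "\<forall>\<^sub>F j in sequentially. \<bar>m\<bar> * lil (real (t j)) \<le> real (t j) / 2"
    by (rule eventually_compose_filterlim)
      (rule filterlim_compose[OF filterlim_real_sequentially t_top])
  have "\<forall>\<^sub>F j in sequentially. max K 3 \<le> t j" using t_top unfolding filterlim_at_top by blast
  moreover note small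
  moreover have "\<forall>\<^sub>F j::nat in sequentially. lil (3 * real j) \<le> 2 * lil (real j)"
    by (rule eventually_compose_filterlim[OF lil_triple filterlim_real_sequentially])
  moreover have "\<forall>\<^sub>F j::nat in sequentially. 1 \<le> lil (real j)"
    by (rule eventually_compose_filterlim[OF lil_ge_1 filterlim_real_sequentially])
  moreover have "\<forall>\<^sub>F j::nat in sequentially. 3 \<le> j" by (rule eventually_ge_at_top)
  ultimately have "\<forall>\<^sub>F j in sequentially. \<bar>u j - real j\<bar> \<le> (2 * \<bar>m\<bar> + 2) * lil (real j)"
  proof eventually_elim
    case (elim j)
    have mle: "m * lil x \<le> \<bar>m\<bar> * (2 * lil (real j))" if "3 \<le> x" "x \<le> 3 * real j" for x
    proof -
      have "lil x \<le> 2 * lil (real j)" using lil_mono[OF that] elim by linarith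
      moreover have "0 \<le> lil x" using that by (intro lil_nonneg)
      ultimately show ?thesis by (intro mult_mono) auto
    qed
    have lo: "\<bar>real (card {i. u i \<le> real (t j)}) - real (t j)\<bar> \<le> m * lil (real (t j))"
      and hi: "\<bar>real (card {i. u i \<le> real (Suc (t j))}) - real (Suc (t j))\<bar> \<le> m * lil (real (Suc (t j)))"
      using elim by (intro N; simp)+
    have "m * lil (real (t j)) \<le> \<bar>m\<bar> * lil (real (t j))"
      using elim by (intro mult_right_mono lil_nonneg) auto
    then have "real (t j) / 2 \<le> real (card {i. u i \<le> real (t j)})" using lo elim by linarith
    \<comment> \<open>This a priori bound gives t j + 1 \<le> 3 j for j \<ge> 3, so that
      \<open>lil_triple\<close> replaces the error terms at t j and t j + 1 by one at j.\<close>
    then have "real (t j) \<le> 2 * real j + 2" using N_le[of j] by linarith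
    then have "m * lil (real (t j)) \<le> \<bar>m\<bar> * (2 * lil (real j))"
       "m * lil (real (Suc (t j))) \<le> \<bar>m\<bar> * (2 * lil (real j))"
      using elim by (intro mle; simp)+
    moreover have "(2 * \<bar>m\<bar> + 2) * lil (real j) = \<bar>m\<bar> * (2 * lil (real j)) + 2 * lil (real j)"
      by (simp add: algebra_simps)
    moreover have "real (Suc (t j)) = real (t j) + 1" "real (Suc j) = real j + 1" by simp_all
    moreover have "real (card {i. u i \<le> real (t j)}) \<le> real (Suc j)"
      "real (Suc j) \<le> real (card {i. u i \<le> real (Suc (t j))})"
      using N_le[of j] N_ge[of j] by (simp_all only: of_nat_le_iff)
    ultimately show ?case
      using lo hi t[of j] \<open>1 \<le> lil (real j)\<close> by linarith
  qed
  then show ?thesis by blast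
qed

text \<open>The rank \<open>h u\<close>, the number of smaller elements, is strictly increasing on
  \<open>U\<close>. Its image is closed under predecessors, since the largest element below
  \<open>u\<close> has rank one less, and it is infinite; hence it is all of the natural numbers,
  and the inverse of \<open>h\<close> is the enumeration.\<close>

lemma strict_mono_enumeration:
  fixes U :: "real set"
  assumes inf: "infinite U" and fin: "\<And>t. finite {u \<in> U. u \<le> t}"
  shows "\<exists>g::nat \<Rightarrow> real. strict_mono g \<and> range g = U"
proof -
  define h where "h u = card {v \<in> U. v < u}" for u
  have fin': "finite {v \<in> U. v < u}" for u
    by (rule finite_subset[OF _ fin[of u]]) auto
  have h_less: "h u < h v" if "u \<in> U" "u < v" for u v
    unfolding h_def using that fin' by (intro psubset_card_mono) force+
  have "inj_on h U"
    by (rule inj_onI) (metis h_less less_irrefl linorder_less_linear)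
  have down: "n \<in> h ` U" if "Suc n \<in> h ` U" for n
  proof -
    from that obtain u where u: "Suc n = h u" "u \<in> U" by (rule imageE)
    let ?L = "{v \<in> U. v < u}"
    have "?L \<noteq> {}"
    proof
      assume "?L = {}"
      then have "h u = 0" unfolding h_def by (simp only: card.empty)
      with u(1) show False by simp
    qed
    define m where "m = Max ?L"
    have m: "m \<in> ?L" and m_max: "\<And>v. v \<in> ?L \<Longrightarrow> v \<le> m"
      unfolding m_def using Max_in[OF fin' \<open>?L \<noteq> {}\<close>] Max_ge[OF fin'] by blast+
    have "?L = insert m {v \<in> U. v < m}" using m m_max by force
    then have "h u = Suc (h m)" using fin'[of m] by (simp add: h_def)
    then show ?thesis using u m by auto
  qed
  have ub: "n \<in> h ` U" for n
  proof -
    have "infinite (h ` U)" using \<open>inj_on h U\<close> inf finite_imageD by blast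
    then obtain m where "m \<in> h ` U" "n \<le> m" by (meson infinite_nat_iff_unbounded_le)
    from this(2,1) show ?thesis by (induction rule: inc_induct) (auto intro: down)
  qed
  then have "bij_betw h U UNIV" using \<open>inj_on h U\<close> by (auto simp: bij_betw_def)
  then obtain g where g: "\<And>n. g n \<in> U" "\<And>n. h (g n) = n" "range g = U"
    by (metis bij_betw_def bij_betw_inv_into f_inv_into_f inv_into_into rangeI)
  have "strict_mono g"
  proof (rule strict_monoI)
    fix m n :: nat assume "m < n"
    show "g m < g n"
    proof (rule ccontr)
      assume "\<not> ?thesis"
      then have "g n = g m \<or> g n < g m" by linarith
      then have "h (g n) \<le> h (g m)" using h_less[of "g n" "g m"] g(1) by auto
      with \<open>m < n\<close> show False by (simp add: g)
    qed
  qed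
  then show ?thesis using g(3) by blast
qed

lemma lil_enumeration:
  fixes U :: "real set"
  assumes pos: "\<And>u. u \<in> U \<Longrightarrow> 0 < u" and fin: "\<And>t::nat. finite {u \<in> U. u \<le> real t}"
    and card: "\<And>t. K \<le> t \<Longrightarrow> \<bar>real (card {u \<in> U. u \<le> real t}) - real t\<bar> \<le> m * lil (real t)"
  shows "\<exists>g. strict_mono g \<and> range g = U \<and>
    (\<exists>m. \<forall>\<^sub>F j in sequentially. \<bar>g j - real j\<bar> \<le> m * lil (real j))"
proof -
  \<comment> \<open>The error term is eventually at most t / 2, so the counts are at least t / 2 and
    cannot stay bounded.\<close>
  have "infinite U"
  proof
    assume U: "finite U"
    have "((\<lambda>t. m * (lil t / t)) \<longlongrightarrow> m * 0) at_top" by (intro tendsto_intros lil_div_tendsto_0)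
    then have "\<forall>\<^sub>F t in at_top. m * (lil t / t) < 1 / 2" by (rule order_tendstoD) simp
    then have "\<forall>\<^sub>F t::nat in sequentially. m * (lil (real t) / real t) < 1 / 2"
      by (rule eventually_compose_filterlim[OF _ filterlim_real_sequentially])
    moreover have "\<forall>\<^sub>F t in sequentially. 2 * card U < t \<and> K \<le> t"
      by (intro eventually_conj eventually_gt_at_top eventually_ge_at_top)
    ultimately have "\<forall>\<^sub>F t::nat in sequentially. False"
    proof eventually_elim
      case (elim t)
      then have "m * lil (real t) \<le> real t / 2" by (simp add: field_simps)
      then have "real t \<le> 2 * real (card {u \<in> U. u \<le> real t})" using card[of t] elim by linarith
      moreover have "card {u \<in> U. u \<le> real t} \<le> card U" using U by (intro card_mono) auto
      ultimately show False using elim by linarith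
    qed
    then show False by simp
  qed
  have fin': "finite {u \<in> U. u \<le> t}" for t :: real
  proof (rule finite_subset[OF _ fin[of "nat \<lceil>t\<rceil>"]], rule subsetI)
    fix u assume "u \<in> {u \<in> U. u \<le> t}"
    then show "u \<in> {u \<in> U. u \<le> real (nat \<lceil>t\<rceil>)}" using real_nat_ceiling_ge[of t] by simp
  qed
  obtain g :: "nat \<Rightarrow> real" where g: "strict_mono g" "range g = U"
    using strict_mono_enumeration[OF \<open>infinite U\<close> fin'] by blast
  have im: "{u \<in> U. u \<le> t} = g ` {j. g j \<le> t}" for t using g(2) by auto
  have inj: "inj_on g J" for J by (rule inj_on_subset[OF strict_mono_imp_inj_on[OF g(1)] subset_UNIV])
  have "\<exists>m. \<forall>\<^sub>F j in sequentially. \<bar>g j - real j\<bar> \<le> m * lil (real j)"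
  proof (rule lil_inversion[OF g(1)])
    show "0 \<le> g j" for j using pos[of "g j"] g(2) by (auto simp: less_imp_le)
    show "finite {j. g j \<le> t}" for t using fin'[of t] unfolding im by (rule finite_imageD) (rule inj)
    show "\<bar>real (card {j. g j \<le> real t}) - real t\<bar> \<le> m * lil (real t)" if "K \<le> t" for t
      using card[OF that] unfolding im card_image[OF inj] .
  qed
  with g show ?thesis by blast
qed

section \<open>Peeling with a prescribed growth of the points\<close>

lemma powr_minus_one_bound:
  fixes b :: real
  assumes Y: "(Y \<longlongrightarrow> 1) F"
  shows "\<exists>L\<ge>0. \<forall>\<^sub>F k in F. \<bar>Y k powr b - 1\<bar> \<le> L * \<bar>Y k - 1\<bar>"
proof -
  have "((\<lambda>y::real. y powr b) has_real_derivative b * 1 powr (b - 1)) (at 1)"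
    by (rule has_real_derivative_powr) simp
  then have "((\<lambda>y. (y powr b - 1) / (y - 1)) \<longlongrightarrow> b) (at 1)"
    by (simp add: has_field_derivative_iff)
  then have "((\<lambda>y. \<bar>(y powr b - 1) / (y - 1)\<bar>) \<longlongrightarrow> \<bar>b\<bar>) (at 1)" by (rule tendsto_rabs)
  then have "\<forall>\<^sub>F y in at 1. \<bar>(y powr b - 1) / (y - 1)\<bar> < \<bar>b\<bar> + 1" by (rule order_tendstoD) simp
  \<comment> \<open>At y = 1 both sides vanish, so the punctured neighbourhood becomes a full one;
    this matters because \<open>Y\<close> may take the value 1.\<close>
  then have "\<forall>\<^sub>F y in nhds 1. \<bar>y powr b - 1\<bar> \<le> (\<bar>b\<bar> + 1) * \<bar>y - 1\<bar>"
    unfolding eventually_at_filter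
    by (rule eventually_mono) (force simp: abs_divide divide_less_eq)
  then have "\<forall>\<^sub>F k in F. \<bar>Y k powr b - 1\<bar> \<le> (\<bar>b\<bar> + 1) * \<bar>Y k - 1\<bar>"
    using Y unfolding filterlim_iff by blast
  then show ?thesis by (intro exI[of _ "\<bar>b\<bar> + 1"]) auto
qed

text \<open>The deterministic core: for a single outcome, the growth of the coordinates
  \<open>U\<close> alone determines the rate of the hulls.\<close>

lemma peel_hull_rate:
  fixes a :: "'i \<Rightarrow> 'a::euclidean_space" and U :: "'i \<Rightarrow> nat \<Rightarrow> real"
  assumes I: "finite I" "I \<noteq> {}" "inj_on a I" and ext: "ext (convex hull (a ` I)) = a ` I"
    and distinct: "\<And>i j s t. \<lbrakk>i \<in> I; j \<in> I; i \<noteq> j; 0 < s; 0 < t\<rbrakk> \<Longrightarrow> s *\<^sub>R a i \<noteq> t *\<^sub>R a j"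
    and nz: "\<And>i. i \<in> I \<Longrightarrow> a i \<noteq> 0"
    and zero: "\<And>w. (\<And>i. i \<in> I \<Longrightarrow> 0 < w i) \<Longrightarrow> 0 \<in> convex hull ((\<lambda>i. w i *\<^sub>R a i) ` I)"
    and U: "\<And>i. i \<in> I \<Longrightarrow> strict_mono (U i)" "\<And>i j. i \<in> I \<Longrightarrow> 0 < U i j"
    and rate: "\<And>i. i \<in> I \<Longrightarrow> \<exists>m. \<forall>\<^sub>F j in sequentially. \<bar>U i j - real j\<bar> \<le> m * lil (real j)"
    and \<beta>: "0 < \<beta>"
  defines "X \<equiv> {U i j powr (-\<beta>) *\<^sub>R a i | i j. i \<in> I}"
  shows "\<exists>s m. (\<forall>k\<ge>1. peel_hull X k = convex hull ((\<lambda>i. s k i *\<^sub>R a i) ` I)) \<and>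
           (\<forall>\<^sub>F k in sequentially. \<forall>i\<in>I. 0 < s k i \<and>
              \<bar>real k powr \<beta> * s k i - 1\<bar> \<le> m * sqrt (ln (ln (real k)) / real k))"
proof -
  define r where "r i j = U i j powr (-\<beta>)" for i j
  interpret ray_peeling I a r
  proof
    show "r i q < r i p" if "i \<in> I" "p < q" for i p q
      unfolding r_def using U that \<beta> by (intro powr_less_mono2_neg) (auto simp: strict_mono_def)
    show "0 < r i p" if "i \<in> I" for i p
      using U(2)[OF that, of p] by (simp add: r_def)
  qed (use I distinct nz zero in auto)
  have X: "X = rest (\<lambda>_. 0)" by (simp add: X_def rest_def r_def)

  obtain m where "\<forall>i\<in>I. \<forall>\<^sub>F j in sequentially. \<bar>U i j - real j\<bar> \<le> m i * lil (real j)"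
    using rate by metis
  then have ev_m: "\<forall>\<^sub>F j in sequentially. \<forall>i\<in>I. \<bar>U i j - real j\<bar> \<le> m i * lil (real j)"
    by (intro eventually_ball_finite I)
  define m' where "m' = (\<Sum>i\<in>I. \<bar>m i\<bar>)"
  have m': "m i \<le> m'" "0 \<le> m'" if "i \<in> I" for i
    using member_le_sum[of i I "\<lambda>i. \<bar>m i\<bar>"] that I by (auto simp: m'_def sum_nonneg)
  have "\<forall>\<^sub>F j in sequentially. \<forall>i\<in>I. \<bar>U i j - real j\<bar> \<le> m' * lil (real j)"
    using ev_m eventually_ge_at_top[of 3]
  proof eventually_elim
    case (elim j)
    then show ?case
      using m' lil_nonneg[of "real j"] by (force intro: order_trans mult_right_mono)
  qed
  then obtain N0 where N0: "\<And>i j. \<lbrakk>i \<in> I; N0 \<le> j\<rbrakk> \<Longrightarrow> \<bar>U i j - real j\<bar> \<le> m' * lil (real j)"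
    unfolding eventually_sequentially by blast

  have lil_small: "\<forall>\<^sub>F j::nat in sequentially. m' * lil (real j) \<le> \<eta> * real j" if "0 < \<eta>" for \<eta>
  proof -
    have "((\<lambda>t. m' * (lil t / t)) \<longlongrightarrow> m' * 0) at_top" by (intro tendsto_intros lil_div_tendsto_0)
    then have "\<forall>\<^sub>F t in at_top. m' * (lil t / t) < \<eta>" using that by (intro order_tendstoD) auto
    then have "\<forall>\<^sub>F t in at_top. m' * lil t \<le> \<eta> * t"
      using eventually_gt_at_top[of 0] by eventually_elim (simp add: field_simps)
    then show ?thesis by (rule eventually_compose_filterlim[OF _ filterlim_real_sequentially])
  qed
  have r_lim: "r i \<longlonglongrightarrow> 0" if i: "i \<in> I" for i
  proof -
    have "filterlim (\<lambda>j. real j / 2) at_top sequentially" by real_asymp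
    moreover have "\<forall>\<^sub>F j in sequentially. real j / 2 \<le> U i j"
      using lil_small[OF half_gt_zero[OF zero_less_one]] eventually_ge_at_top[of N0]
    proof eventually_elim
      case (elim j)
      then show ?case using N0[OF i, of j] by simp
    qed
    ultimately have "filterlim (U i) at_top sequentially" by (rule filterlim_at_top_mono)
    then show ?thesis unfolding r_def using \<beta> by (intro tendsto_neg_powr) auto
  qed

  obtain \<epsilon> where \<epsilon>: "0 < \<epsilon>" and slack: "\<And>i s. \<lbrakk>i \<in> I; \<forall>j\<in>I. 0 < s j \<and> s j \<le> (1 + \<epsilon>) * s i\<rbrakk> \<Longrightarrow>
      s i *\<^sub>R a i \<notin> convex hull ((\<lambda>j. s j *\<^sub>R a j) ` (I - {i}))"
    using extreme_slack[OF I(1,3) ext _ nz] zero[of "\<lambda>_. 1"] by auto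
  \<comment> \<open>\<open>q\<close> carries the slack over to the coordinates: U_j \<ge> q U_i
    means r_j \<le> (1 + \<epsilon>) r_i.\<close>
  define q where "q = (1 + \<epsilon>) powr (- 1 / \<beta>)"
  have q: "0 < q" "q < 1" "q powr (-\<beta>) = 1 + \<epsilon>"
    using \<epsilon> \<beta> powr_less_one[of "1 + \<epsilon>" "- 1 / \<beta>"] by (auto simp: q_def powr_powr)
  \<comment> \<open>\<open>\<eta>\<close> is the relative error that the coordinates may have: if
    n_i \<le> n_j, then q U_i \<le> q (1 + \<eta>) n_i \<le> (1 - \<eta>) n_j \<le> U_j.\<close>
  define \<eta> where "\<eta> = (1 - q) / 2"
  have \<eta>: "0 < \<eta>" using q by (simp add: \<eta>_def)
  have \<eta>q: "q * (1 + \<eta>) \<le> 1 - \<eta>"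
  proof -
    have "(1 - \<eta>) - q * (1 + \<eta>) = (1 - q)\<^sup>2 / 2" by (simp add: \<eta>_def power2_eq_square field_simps)
    then show ?thesis using zero_le_power2[of "1 - q"] by linarith
  qed
  obtain N1 where N1: "\<And>j. N1 \<le> j \<Longrightarrow> m' * lil (real j) \<le> \<eta> * real j"
    using lil_small[OF \<eta>] unfolding eventually_sequentially by blast
  have "\<exists>c. \<forall>k. \<forall>i\<in>I. k \<le> removed k i + c"
  proof (rule removed_ge[where N = "max N0 N1", OF r_lim])
    fix n i assume i: "i \<in> I" and n: "\<And>j. j \<in> I \<Longrightarrow> max N0 N1 \<le> n j \<and> n i \<le> n j"
    show "step n i = Suc (n i)"
    proof (rule step_eq_Suc[OF i], rule slack[OF i], intro ballI conjI)
      fix j assume j: "j \<in> I"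
      show "0 < r j (n j)" using j by (rule r_pos)
      have "q * U i (n i) \<le> q * ((1 + \<eta>) * real (n i))"
        using N0[OF i, of "n i"] N1[of "n i"] n[OF i] q by (intro mult_left_mono) (auto simp: algebra_simps)
      also have "\<dots> = (q * (1 + \<eta>)) * real (n i)" by simp
      also have "\<dots> \<le> (1 - \<eta>) * real (n i)" using \<eta>q by (intro mult_right_mono) auto
      also have "\<dots> \<le> (1 - \<eta>) * real (n j)" using n[OF j] q by (intro mult_left_mono) (auto simp: \<eta>_def)
      also have "\<dots> \<le> U j (n j)"
        using N0[OF j, of "n j"] N1[of "n j"] n[OF j] by (auto simp: algebra_simps)
      finally have "U j (n j) powr (-\<beta>) \<le> (q * U i (n i)) powr (-\<beta>)"
        using U(2)[OF i, of "n i"] q \<beta> by (intro powr_mono2') auto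
      also have "\<dots> = (1 + \<epsilon>) * U i (n i) powr (-\<beta>)"
        using U(2)[OF i, of "n i"] q by (simp add: powr_mult)
      finally show "r j (n j) \<le> (1 + \<epsilon>) * r i (n i)" by (simp add: r_def)
    qed
  qed
  then obtain c where c: "\<And>k i. i \<in> I \<Longrightarrow> k \<le> removed k i + c" by blast

  \<comment> \<open>Only k - 1 rounds precede round k; this turns the lag \<open>c\<close> into
    \<open>c + 1\<close>.\<close>
  define idx where "idx k i = removed (k - 1) i" for k i
  define s where "s k i = r i (idx k i)" for k i
  have idx: "idx k i \<le> k" "k \<le> idx k i + (c + 1)" if "i \<in> I" for k i
    using removed_le[of "k - 1" i] c[OF that, of "k - 1"] by (auto simp: idx_def)
  have hull: "peel_hull X k = convex hull ((\<lambda>i. s k i *\<^sub>R a i) ` I)" if "1 \<le> k" for k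
    using peel_hull_eq[of "k - 1"] that by (simp add: X tops_def s_def idx_def)
  \<comment> \<open>\<open>M\<close> collects the fluctuation \<open>m'\<close> of the coordinates
    and the index lag \<open>c + 1\<close>, which is multiplied by \<open>lil (real k)\<close>,
    eventually at least 1. The threshold \<open>N0 + c + 4\<close> ensures that the index is at
    least \<open>N0 + 3\<close>, within the range of \<open>N0\<close> and of
    \<open>lil_mono\<close>.\<close>
  define M where "M = m' + c + 1"
  have close: "\<forall>\<^sub>F k in sequentially. \<bar>U i (idx k i) / real k - 1\<bar> \<le> M * sqrt (ln (ln (real k)) / real k)"
    if i: "i \<in> I" for i
    using eventually_ge_at_top[of "N0 + c + 4"]
      eventually_compose_filterlim[OF lil_div filterlim_real_sequentially]
      eventually_compose_filterlim[OF lil_ge_1 filterlim_real_sequentially]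
  proof eventually_elim
    case (elim k)
    have "\<bar>U i (idx k i) - real (idx k i)\<bar> \<le> m' * lil (real (idx k i))"
      using idx[OF i, of k] elim by (intro N0[OF i]) simp
    also have "\<dots> \<le> m' * lil (real k)"
      using idx[OF i, of k] elim m'(2)[OF i] by (intro mult_left_mono lil_mono) auto
    finally have "\<bar>U i (idx k i) - real k\<bar> \<le> m' * lil (real k) + (c + 1)"
      using idx[OF i, of k] by linarith
    also have "\<dots> \<le> M * lil (real k)"
      using mult_left_mono[OF elim(3), of "real c + 1"] by (simp add: M_def algebra_simps)
    finally have "\<bar>U i (idx k i) - real k\<bar> / real k \<le> (M * lil (real k)) / real k"
      by (rule divide_right_mono) simp
    also have "\<dots> = M * (lil (real k) / real k)" by simp
    finally have "\<bar>U i (idx k i) - real k\<bar> / real k \<le> M * (lil (real k) / real k)" .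
    moreover have "U i (idx k i) / real k - 1 = (U i (idx k i) - real k) / real k"
      using elim by (simp add: diff_divide_distrib)
    ultimately show ?case using elim by (simp add: abs_divide)
  qed
  have "\<exists>L\<ge>0. \<forall>\<^sub>F k in sequentially. \<bar>(U i (idx k i) / real k) powr (-\<beta>) - 1\<bar>
      \<le> L * \<bar>U i (idx k i) / real k - 1\<bar>" if i: "i \<in> I" for i
  proof (rule powr_minus_one_bound)
    have "(\<lambda>k. ln (ln (real k)) / real k) \<longlonglongrightarrow> 0" by real_asymp
    then have "(\<lambda>k. M * sqrt (ln (ln (real k)) / real k)) \<longlonglongrightarrow> M * sqrt 0"
      by (intro tendsto_intros)
    then have lim: "(\<lambda>k. M * sqrt (ln (ln (real k)) / real k)) \<longlonglongrightarrow> 0" by simp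
    have "(\<lambda>k. U i (idx k i) / real k - 1) \<longlonglongrightarrow> 0"
      by (rule Lim_null_comparison[OF _ lim]) (simp only: real_norm_def close[OF i])
    then show "(\<lambda>k. U i (idx k i) / real k) \<longlonglongrightarrow> 1" by (simp add: LIM_zero_iff)
  qed
  then have "\<forall>i\<in>I. \<exists>L. 0 \<le> L \<and> (\<forall>\<^sub>F k in sequentially.
      \<bar>(U i (idx k i) / real k) powr (-\<beta>) - 1\<bar> \<le> L * \<bar>U i (idx k i) / real k - 1\<bar>)"
    by blast
  from bchoice[OF this] obtain L where L: "\<And>i. i \<in> I \<Longrightarrow> 0 \<le> L i"
    "\<And>i. i \<in> I \<Longrightarrow> \<forall>\<^sub>F k in sequentially. \<bar>(U i (idx k i) / real k) powr (-\<beta>) - 1\<bar>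
      \<le> L i * \<bar>U i (idx k i) / real k - 1\<bar>"
    by blast
  have "\<forall>\<^sub>F k in sequentially. \<forall>i\<in>I. 0 < s k i \<and>
              \<bar>real k powr \<beta> * s k i - 1\<bar> \<le> (sum L I * M) * sqrt (ln (ln (real k)) / real k)"
  proof (rule eventually_ball_finite[OF I(1)], rule ballI)
    fix i assume i: "i \<in> I"
    show "\<forall>\<^sub>F k in sequentially. 0 < s k i \<and>
              \<bar>real k powr \<beta> * s k i - 1\<bar> \<le> (sum L I * M) * sqrt (ln (ln (real k)) / real k)"
      using L(2)[OF i] close[OF i] eventually_gt_at_top[of 0]
    proof eventually_elim
      case (elim k)
      have "real k powr \<beta> * s k i = (U i (idx k i) / real k) powr (-\<beta>)"
        using U(2)[OF i, of "idx k i"] elim(3) by (simp add: s_def r_def powr_divide powr_minus field_simps)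
      then have "\<bar>real k powr \<beta> * s k i - 1\<bar> \<le> L i * \<bar>U i (idx k i) / real k - 1\<bar>"
        using elim(1) by simp
      also have "\<dots> \<le> sum L I * (M * sqrt (ln (ln (real k)) / real k))"
        using elim(2) L(1) i I by (intro mult_mono member_le_sum sum_nonneg) auto
      finally show ?case using r_pos[OF i] by (simp add: s_def mult.assoc)
    qed
  qed
  with hull show ?thesis by blast
qed

section \<open>A maximal inequality and deviations of Poisson counts\<close>

text \<open>When the partial sums first reach \<open>2 * a\<close> in absolute value, the remaining
  increment is independent of the past and stays below \<open>a\<close> with probability at least 1
  / 2. In that case the final sum is still at least \<open>a\<close> in absolute value.\<close>

lemma (in prob_space) ottaviani_inequality:
  fixes X :: "nat \<Rightarrow> 'a \<Rightarrow> real"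
  assumes indep: "indep_vars (\<lambda>_. borel) X {..<n}"
    and half: "\<And>j. j \<le> n \<Longrightarrow> prob {\<omega> \<in> space M. a \<le> \<bar>\<Sum>i\<in>{j..<n}. X i \<omega>\<bar>} \<le> 1 / 2"
  shows "prob {\<omega> \<in> space M. \<exists>j\<le>n. 2 * a \<le> \<bar>\<Sum>i<j. X i \<omega>\<bar>}
    \<le> 2 * prob {\<omega> \<in> space M. a \<le> \<bar>\<Sum>i<n. X i \<omega>\<bar>}"
proof -
  have X: "X i \<in> borel_measurable M" if "i < n" for i
    using indep that unfolding indep_vars_def by auto
  have meas: "(\<lambda>\<omega>. \<Sum>i\<in>J. X i \<omega>) \<in> borel_measurable M" if "J \<subseteq> {..<n}" for J
    using that by (intro borel_measurable_sum X) auto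
  define S where "S j \<omega> = (\<Sum>i<j. X i \<omega>)" for j \<omega>
  have S [measurable]: "S j \<in> borel_measurable M" if "j \<le> n" for j
    unfolding S_def using that by (intro meas) auto
  have split: "S n \<omega> = S j \<omega> + (\<Sum>i\<in>{j..<n}. X i \<omega>)" if "j \<le> n" for j \<omega>
    unfolding S_def using that by (simp add: lessThan_atLeast0 sum.atLeastLessThan_concat)
  \<comment> \<open>Decompose by the first index at which the partial sums reach \<open>2 a\<close>.\<close>
  define A where "A j = {\<omega> \<in> space M. 2 * a \<le> \<bar>S j \<omega>\<bar> \<and> (\<forall>i<j. \<bar>S i \<omega>\<bar> < 2 * a)}" for j
  define B where "B j = {\<omega> \<in> space M. \<bar>\<Sum>i\<in>{j..<n}. X i \<omega>\<bar> < a}" for j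
  have A: "A j \<in> events" if j: "j \<le> n" for j
  proof -
    have "{\<omega> \<in> space M. 2 * a \<le> \<bar>S j \<omega>\<bar>} \<in> events" using S[OF j] by measurable
    moreover have "{\<omega> \<in> space M. \<bar>S i \<omega>\<bar> < 2 * a} \<in> events" if "i < j" for i
    proof -
      have [measurable]: "S i \<in> borel_measurable M" using that j by (intro S) simp
      show ?thesis by measurable
    qed
    ultimately show ?thesis
      unfolding A_def by (intro sets.sets_Collect_conj sets.sets_Collect_finite_All') auto
  qed
  have B: "B j \<in> events" for j
    using meas[of "{j..<n}"] unfolding B_def by measurable auto
  have disj: "disjoint_family_on A {..n}"
    unfolding disjoint_family_on_def A_def
    by (auto simp: not_less) (metis linorder_neqE_nat not_less)+
  have AB: "prob (A j \<inter> B j) = prob (A j) * prob (B j)" if j: "j \<le> n" for j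
  proof -
    \<comment> \<open>Past and future become random elements of two product spaces, so that
      \<open>A j\<close> and \<open>B j\<close> are preimages of measurable sets under independent
      maps.\<close>
    let ?PA = "PiM {..<j} (\<lambda>_. borel :: real measure)" and ?PB = "PiM {j..<n} (\<lambda>_. borel :: real measure)"
    let ?RA = "\<lambda>\<omega>. restrict (\<lambda>i. X i \<omega>) {..<j}" and ?RB = "\<lambda>\<omega>. restrict (\<lambda>i. X i \<omega>) {j..<n}"
    define Xa where "Xa = {x \<in> space ?PA. 2 * a \<le> \<bar>\<Sum>i<j. x i\<bar> \<and> (\<forall>k<j. \<bar>\<Sum>i<k. x i\<bar> < 2 * a)}"
    define Xb where "Xb = {x \<in> space ?PB. \<bar>\<Sum>i\<in>{j..<n}. x i\<bar> < a}"
    have "indep_var ?PA ?RA ?PB ?RB"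
      using j by (intro indep_var_restrict[OF indep]) auto
    moreover have "Xa \<in> sets ?PA"
    proof -
      have sm: "(\<lambda>x. \<Sum>i<k. x i) \<in> borel_measurable ?PA" if "k \<le> j" for k
        using that by (intro borel_measurable_sum measurable_component_singleton) auto
      have "{x \<in> space ?PA. 2 * a \<le> \<bar>\<Sum>i<j. x i\<bar>} \<in> sets ?PA"
        using sm[of j] by measurable
      moreover have "{x \<in> space ?PA. \<bar>\<Sum>i<k. x i\<bar> < 2 * a} \<in> sets ?PA" if "k < j" for k
      proof -
        have [measurable]: "(\<lambda>x. \<Sum>i<k. x i) \<in> borel_measurable ?PA" using that by (intro sm) simp
        show ?thesis by measurable
      qed
      ultimately show ?thesis
        unfolding Xa_def by (intro sets.sets_Collect_conj sets.sets_Collect_finite_All') auto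
    qed
    moreover have "Xb \<in> sets ?PB"
    proof -
      have "(\<lambda>x. \<Sum>i\<in>{j..<n}. x i) \<in> borel_measurable ?PB"
        by (intro borel_measurable_sum measurable_component_singleton) auto
      then show ?thesis unfolding Xb_def by measurable
    qed
    ultimately have "prob ((\<lambda>x. (?RA x, ?RB x)) -` (Xa \<times> Xb) \<inter> space M) =
        prob (?RA -` Xa \<inter> space M) * prob (?RB -` Xb \<inter> space M)"
      by (rule indep_varD)
    moreover have "?RA -` Xa \<inter> space M = A j"
      by (auto simp: Xa_def A_def S_def space_PiM)
    moreover have "?RB -` Xb \<inter> space M = B j"
      by (auto simp: Xb_def B_def space_PiM)
    moreover have "(\<lambda>x. (?RA x, ?RB x)) -` (Xa \<times> Xb) \<inter> space M =
        (?RA -` Xa \<inter> space M) \<inter> (?RB -` Xb \<inter> space M)" by blast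
    ultimately show ?thesis by simp
  qed
  have halfB: "prob (A j) \<le> 2 * prob (A j \<inter> B j)" if j: "j \<le> n" for j
  proof -
    have "B j = space M - {\<omega> \<in> space M. a \<le> \<bar>\<Sum>i\<in>{j..<n}. X i \<omega>\<bar>}" by (auto simp: B_def)
    moreover have "{\<omega> \<in> space M. a \<le> \<bar>\<Sum>i\<in>{j..<n}. X i \<omega>\<bar>} \<in> events"
      using meas[of "{j..<n}"] by measurable auto
    ultimately have "1 / 2 \<le> prob (B j)" using half[OF j] by (simp add: prob_compl)
    then have "prob (A j) * (1 / 2) \<le> prob (A j) * prob (B j)" by (rule mult_left_mono) simp
    then show ?thesis using AB[OF j] by simp
  qed
  have "{\<omega> \<in> space M. \<exists>j\<le>n. 2 * a \<le> \<bar>\<Sum>i<j. X i \<omega>\<bar>} = (\<Union>j\<le>n. A j)"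
  proof (intro equalityI subsetI)
    fix \<omega> assume "\<omega> \<in> {\<omega> \<in> space M. \<exists>j\<le>n. 2 * a \<le> \<bar>\<Sum>i<j. X i \<omega>\<bar>}"
    then obtain j where j: "\<omega> \<in> space M" "j \<le> n" "2 * a \<le> \<bar>S j \<omega>\<bar>" by (auto simp: S_def)
    define k where "k = (LEAST k. 2 * a \<le> \<bar>S k \<omega>\<bar>)"
    have "2 * a \<le> \<bar>S k \<omega>\<bar>" "k \<le> j" "\<And>i. i < k \<Longrightarrow> \<bar>S i \<omega>\<bar> < 2 * a"
      unfolding k_def using j(3)
      by (rule LeastI, rule Least_le) (use not_less_Least in \<open>force simp: not_le\<close>)
    then show "\<omega> \<in> (\<Union>j\<le>n. A j)" using j by (auto simp: A_def)
  qed (auto simp: A_def S_def)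
  also have "prob (\<Union>j\<le>n. A j) = (\<Sum>j\<le>n. prob (A j))"
    using A disj by (intro finite_measure_finite_Union) auto
  also have "\<dots> \<le> (\<Sum>j\<le>n. 2 * prob (A j \<inter> B j))"
    by (intro sum_mono halfB) auto
  also have "\<dots> = 2 * (\<Sum>j\<le>n. prob (A j \<inter> B j))" by (simp add: sum_distrib_left)
  also have "(\<Sum>j\<le>n. prob (A j \<inter> B j)) = prob (\<Union>j\<le>n. A j \<inter> B j)"
  proof (rule finite_measure_finite_Union[symmetric])
    show "disjoint_family_on (\<lambda>j. A j \<inter> B j) {..n}"
      using disj unfolding disjoint_family_on_def by blast
  qed (use A B in auto)
  also have "prob (\<Union>j\<le>n. A j \<inter> B j) \<le> prob {\<omega> \<in> space M. a \<le> \<bar>S n \<omega>\<bar>}"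
  proof (rule finite_measure_mono)
    show "{\<omega> \<in> space M. a \<le> \<bar>S n \<omega>\<bar>} \<in> events" using S[of n] by measurable
    show "(\<Union>j\<le>n. A j \<inter> B j) \<subseteq> {\<omega> \<in> space M. a \<le> \<bar>S n \<omega>\<bar>}"
    proof
      fix \<omega> assume "\<omega> \<in> (\<Union>j\<le>n. A j \<inter> B j)"
      then obtain j where "j \<le> n" "\<omega> \<in> space M" "2 * a \<le> \<bar>S j \<omega>\<bar>" "\<bar>\<Sum>i\<in>{j..<n}. X i \<omega>\<bar> < a"
        by (auto simp: A_def B_def)
      with split[of j \<omega>] show "\<omega> \<in> {\<omega> \<in> space M. a \<le> \<bar>S n \<omega>\<bar>}" by auto
    qed
  qed
  finally show ?thesis by (simp add: S_def)
qed

lemma exp_abs_le_quadratic: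
  fixes x :: real
  assumes "\<bar>x\<bar> \<le> 1"
  shows "exp x \<le> 1 + x + x\<^sup>2"
proof (cases "0 \<le> x")
  case True
  then show ?thesis using exp_bound[of x] assms by simp
next
  case False
  define y where "y = - x"
  have y: "0 \<le> y" "y \<le> 1" using False assms by (auto simp: y_def)
  \<comment> \<open>The product equals 1 + y^3; bounding 1 + y by exp y then settles negative
    arguments.\<close>
  have "1 * 1 \<le> (1 + y) * (1 - y + y\<^sup>2)"
    using y by (simp add: algebra_simps power2_eq_square power3_eq_cube)
  also have "\<dots> \<le> exp y * (1 - y + y\<^sup>2)"
    using y exp_ge_add_one_self[of y] by (intro mult_right_mono) auto
  finally have "exp (- y) * 1 \<le> exp (- y) * (exp y * (1 - y + y\<^sup>2))" by (intro mult_left_mono) auto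
  also have "\<dots> = 1 - y + y\<^sup>2" by (simp add: exp_minus)
  finally show ?thesis by (simp add: y_def)
qed

section \<open>Tail bounds for Poisson counts\<close>

context poisson_process
begin

text \<open>Countable additivity extends the Poisson law from single values to sets of values, which
  is the form that exponential estimates need.\<close>

lemma prob_count_in:
  assumes B: "B \<in> sets \<mu>" "emeasure \<mu> B < \<infinity>"
  shows "{\<omega> \<in> space M. \<exists>k\<in>K. point_count \<xi> B \<omega> = of_nat k} \<in> events"
    and "(\<lambda>k. of_bool (k \<in> K) * (exp (- measure \<mu> B) * measure \<mu> B ^ k / fact k)) sums
      prob {\<omega> \<in> space M. \<exists>k\<in>K. point_count \<xi> B \<omega> = of_nat k}"
proof -
  define E where "E k = (if k \<in> K then {\<omega> \<in> space M. point_count \<xi> B \<omega> = of_nat k} else {})" for k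
  have E: "E k \<in> events" for k
  proof -
    have [measurable]: "point_count \<xi> B \<in> borel_measurable M" by (rule random_variable_count[OF B(1)])
    have "{\<omega> \<in> space M. point_count \<xi> B \<omega> = of_nat k} \<in> events" by measurable
    then show ?thesis by (simp add: E_def)
  qed
  have "(\<lambda>k. prob (E k)) sums prob (\<Union>k. E k)"
    by (intro finite_measure_UNION image_subsetI E) (auto simp: disjoint_family_on_def E_def split: if_splits)
  moreover have "(\<Union>k. E k) = {\<omega> \<in> space M. \<exists>k\<in>K. point_count \<xi> B \<omega> = of_nat k}"
    by (auto simp: E_def split: if_splits)
  moreover have "prob (E k) = of_bool (k \<in> K) * (exp (- measure \<mu> B) * measure \<mu> B ^ k / fact k)" for k
    by (simp add: E_def poisson_count[OF B])
  moreover have "(\<Union>k. E k) \<in> events" using E by blast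
  ultimately show "{\<omega> \<in> space M. \<exists>k\<in>K. point_count \<xi> B \<omega> = of_nat k} \<in> events"
    "(\<lambda>k. of_bool (k \<in> K) * (exp (- measure \<mu> B) * measure \<mu> B ^ k / fact k)) sums
      prob {\<omega> \<in> space M. \<exists>k\<in>K. point_count \<xi> B \<omega> = of_nat k}" by simp_all
qed

text \<open>The Poisson weights sum to 1. Finiteness makes \<open>enn2real\<close> faithful on
  counts, since it would send \<infinity> to 0.\<close>

lemma AE_count_finite:
  assumes B: "B \<in> sets \<mu>" "emeasure \<mu> B < \<infinity>"
  shows "AE \<omega> in M. \<exists>k::nat. point_count \<xi> B \<omega> = of_nat k"
proof -
  let ?E = "{\<omega> \<in> space M. \<exists>k\<in>UNIV. point_count \<xi> B \<omega> = of_nat k}" and ?c = "measure \<mu> B"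
  have "(\<lambda>k. exp (- ?c) * (?c ^ k /\<^sub>R fact k)) sums (exp (- ?c) * exp ?c)"
    by (intro sums_mult exp_converges)
  then have "(\<lambda>k. of_bool (k \<in> UNIV) * (exp (- ?c) * ?c ^ k / fact k)) sums 1"
    by (simp add: exp_minus field_simps)
  with prob_count_in(2)[OF B, of UNIV] have "prob ?E = 1" by (rule sums_unique2)
  then have "AE \<omega> in M. \<omega> \<in> ?E" by (rule AE_prob_1)
  then show ?thesis by eventually_elim blast
qed

text \<open>Chernoff's bound, carried out on the series: the indicator of w \<le> s k is at most exp
  (s k - w), and the weighted sum is an exponential series. Both signs of \<open>s\<close> are
  allowed, so it serves both tails.\<close>

lemma prob_count_exponential:
  assumes B: "B \<in> sets \<mu>" "emeasure \<mu> B < \<infinity>"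
  shows "prob {\<omega> \<in> space M. \<exists>k\<in>{k. w \<le> s * real k}. point_count \<xi> B \<omega> = of_nat k}
    \<le> exp (measure \<mu> B * (exp s - 1) - w)"
proof -
  let ?c = "measure \<mu> B"
  have lim: "(\<lambda>k. exp (- ?c - w) * ((?c * exp s) ^ k /\<^sub>R fact k)) sums (exp (- ?c - w) * exp (?c * exp s))"
    by (intro sums_mult exp_converges)
  have le: "of_bool (k \<in> {k. w \<le> s * real k}) * (exp (- ?c) * ?c ^ k / fact k)
      \<le> exp (- ?c - w) * ((?c * exp s) ^ k /\<^sub>R fact k)" for k
  proof -
    have "of_bool (k \<in> {k. w \<le> s * real k}) \<le> exp (s * real k - w)" by auto
    then have "of_bool (k \<in> {k. w \<le> s * real k}) * (exp (- ?c) * ?c ^ k / fact k)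
      \<le> exp (s * real k - w) * (exp (- ?c) * ?c ^ k / fact k)" by (rule mult_right_mono) simp
    also have "\<dots> = exp (- ?c - w) * ((?c * exp s) ^ k /\<^sub>R fact k)"
    proof -
      have "exp (s * real k - w) = exp (real k * s) * exp (- w)" by (simp add: mult.commute flip: exp_add)
      moreover have "exp (- ?c - w) = exp (- ?c) * exp (- w)" by (simp flip: exp_add)
      moreover have "exp (real k * s) = exp s ^ k" by (rule exp_of_nat_mult)
      ultimately show ?thesis
        by (simp only: power_mult_distrib divide_inverse mult_ac real_scaleR_def)
    qed
    finally show ?thesis .
  qed
  have "prob {\<omega> \<in> space M. \<exists>k\<in>{k. w \<le> s * real k}. point_count \<xi> B \<omega> = of_nat k}
      \<le> exp (- ?c - w) * exp (?c * exp s)"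
    by (rule sums_le[OF le prob_count_in(2)[OF B] lim])
  also have "\<dots> = exp (?c * (exp s - 1) - w)"
    by (simp add: algebra_simps flip: exp_add)
  finally show ?thesis .
qed

text \<open>\<open>n\<close> merely dominates the mean, so one bound serves every sub-block of a
  block of length \<open>n\<close>.\<close>

lemma prob_count_deviation:
  assumes B: "B \<in> sets \<mu>" "emeasure \<mu> B < \<infinity>"
    and n: "measure \<mu> B \<le> n" "0 < n" and a: "0 \<le> a" "a \<le> 2 * n"
  shows "prob {\<omega> \<in> space M. a \<le> \<bar>enn2real (point_count \<xi> B \<omega>) - measure \<mu> B\<bar>}
    \<le> 2 * exp (- a\<^sup>2 / (4 * n))"
proof -
  let ?c = "measure \<mu> B"
  define E where "E w s = {\<omega> \<in> space M. \<exists>k\<in>{k. w \<le> s * real k}. point_count \<xi> B \<omega> = of_nat k}"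
    for w s :: real
  \<comment> \<open>This choice minimises n s^2 - s a, with value -a^2 / (4 n), and a \<le> 2 n
    keeps s \<le> 1, within reach of \<open>exp_abs_le_quadratic\<close>.\<close>
  define s where "s = a / (2 * n)"
  have s: "0 \<le> s" "s \<le> 1" using a n by (auto simp: s_def)
  \<comment> \<open>Taken at (x, y) = (s, a) for the upper tail and at (-s, -a) for the lower
    one.\<close>
  have bound: "prob (E (x * (?c + y)) x) \<le> exp (- a\<^sup>2 / (4 * n))" if "\<bar>x\<bar> = s" "x * y = s * a" for x y
  proof -
    have "prob (E (x * (?c + y)) x) \<le> exp (?c * (exp x - 1) - x * (?c + y))"
      unfolding E_def by (rule prob_count_exponential[OF B])
    also have "?c * (exp x - 1) - x * (?c + y) \<le> ?c * (x + x\<^sup>2) - x * (?c + y)"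
      using exp_abs_le_quadratic[of x] that s by (intro diff_right_mono mult_left_mono) auto
    also have "\<dots> = ?c * s\<^sup>2 - s * a" using that by (simp add: algebra_simps flip: that(1))
    also have "\<dots> \<le> n * s\<^sup>2 - s * a" using n by (intro diff_right_mono mult_right_mono) auto
    also have "\<dots> = - a\<^sup>2 / (4 * n)" using n by (simp add: s_def field_simps power2_eq_square)
    finally show ?thesis by simp
  qed
  have E: "E w x \<in> events" for w x unfolding E_def by (rule prob_count_in(1)[OF B])
  define D where "D = {\<omega> \<in> space M. a \<le> \<bar>enn2real (point_count \<xi> B \<omega>) - ?c\<bar>}"
  have D: "D \<in> events"
    unfolding D_def using random_variable_count[OF B(1)] by measurable
  have "prob D \<le> prob (E (s * (?c + a)) s \<union> E (- s * (?c + - a)) (- s))"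
  proof (rule finite_measure_mono_AE)
    show "AE \<omega> in M. \<omega> \<in> D \<longrightarrow> \<omega> \<in> E (s * (?c + a)) s \<union> E (- s * (?c + - a)) (- s)"
      using AE_count_finite[OF B]
    proof eventually_elim
      case (elim \<omega>)
      then obtain k :: nat where k: "point_count \<xi> B \<omega> = of_nat k" by blast
      show ?case
      proof
        assume "\<omega> \<in> D"
        then have "\<omega> \<in> space M" and ak: "a \<le> \<bar>real k - ?c\<bar>" by (auto simp: D_def k enn2real_of_nat)
        from ak have "?c + a \<le> real k \<or> real k \<le> ?c - a" by linarith
        then have "s * (?c + a) \<le> s * real k \<or> - s * (?c + - a) \<le> - s * real k"
          using s by (auto intro: mult_left_mono)
        then show "\<omega> \<in> E (s * (?c + a)) s \<union> E (- s * (?c + - a)) (- s)"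
          using k \<open>\<omega> \<in> space M\<close> by (auto simp: E_def)
      qed
    qed
  qed (use E in blast)
  also have "\<dots> \<le> prob (E (s * (?c + a)) s) + prob (E (- s * (?c + - a)) (- s))"
    by (rule measure_Un_le) (rule E)+
  also have "\<dots> \<le> exp (- a\<^sup>2 / (4 * n)) + exp (- a\<^sup>2 / (4 * n))"
    using s by (intro add_mono bound) auto
  finally show ?thesis by (simp add: D_def)
qed


lemma point_count_UN:
  assumes "finite J" "disjoint_family_on D J"
  shows "point_count \<xi> (\<Union>j\<in>J. D j) \<omega> = (\<Sum>j\<in>J. point_count \<xi> (D j) \<omega>)"
proof -
  have "disjoint_family_on (\<lambda>j. \<xi> \<omega> \<inter> D j) J"
    using assms(2) unfolding disjoint_family_on_def by blast
  then have "(\<Sum>j\<in>J. emeasure (count_space UNIV) (\<xi> \<omega> \<inter> D j))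
      = emeasure (count_space UNIV) (\<Union>j\<in>J. \<xi> \<omega> \<inter> D j)"
    using assms(1) by (intro sum_emeasure) auto
  then show ?thesis unfolding point_count_def by (simp only: Int_UN_distrib)
qed

section \<open>Iterated-logarithm bound along disjoint cells of unit intensity\<close>

context
  fixes D :: "nat \<Rightarrow> 'a set"
  assumes D: "\<And>j. D j \<in> sets \<mu>" "disjoint_family D" and unit: "\<And>j. emeasure \<mu> (D j) = 1"
begin

text \<open>The steps of a random walk whose value at time t compares the number of points in the
  first t cells with its mean t.\<close>

definition centred :: "nat \<Rightarrow> 'w \<Rightarrow> real" where
  "centred j \<omega> = enn2real (point_count \<xi> (D j) \<omega>) - 1"

lemma centred_measurable [measurable]: "centred j \<in> borel_measurable M"
proof -
  have [measurable]: "point_count \<xi> (D j) \<in> borel_measurable M" by (rule random_variable_count[OF D(1)])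
  show ?thesis unfolding centred_def by measurable
qed

lemma disjoint_on: "disjoint_family_on D J"
  using D(2) unfolding disjoint_family_on_def by auto

lemma emeasure_UN_unit:
  assumes "finite J"
  shows "emeasure \<mu> (\<Union>j\<in>J. D j) = of_nat (card J)"
proof -
  have "emeasure \<mu> (\<Union>j\<in>J. D j) = (\<Sum>j\<in>J. emeasure \<mu> (D j))"
    by (rule sum_emeasure[symmetric, OF image_subsetI disjoint_on assms]) (rule D(1))
  then show ?thesis by (simp add: unit)
qed

lemma AE_counts_finite: "AE \<omega> in M. \<forall>j. \<exists>k::nat. point_count \<xi> (D j) \<omega> = of_nat k"
  unfolding AE_all_countable using D(1) unit by (intro allI AE_count_finite) auto

lemma sum_centred:
  assumes "finite J" "\<forall>j. \<exists>k::nat. point_count \<xi> (D j) \<omega> = of_nat k"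
  shows "(\<Sum>j\<in>J. centred j \<omega>) = enn2real (point_count \<xi> (\<Union>j\<in>J. D j) \<omega>) - card J"
proof -
  from choice[OF assms(2)] obtain k :: "nat \<Rightarrow> nat"
    where k: "\<And>j. point_count \<xi> (D j) \<omega> = of_nat (k j)" by blast
  have "point_count \<xi> (\<Union>j\<in>J. D j) \<omega> = of_nat (\<Sum>j\<in>J. k j)"
    by (simp add: point_count_UN[OF assms(1) disjoint_on] k)
  then have "enn2real (point_count \<xi> (\<Union>j\<in>J. D j) \<omega>) = (\<Sum>j\<in>J. real (k j))"
    by (simp add: enn2real_of_nat del: of_nat_sum) simp
  moreover have "centred j \<omega> = real (k j) - 1" for j by (simp add: centred_def k enn2real_of_nat)
  ultimately show ?thesis by (simp add: sum_subtractf)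
qed

text \<open>The sum over \<open>J\<close> is almost surely the centred count of a single set, the
  union of the cells, whose law is Poisson with mean \<open>card J\<close> \<le> n.\<close>

lemma prob_sum_centred:
  assumes J: "J \<subseteq> {..<n}" and n: "0 < n" and a: "0 \<le> a" "a \<le> 2 * real n"
  shows "prob {\<omega> \<in> space M. a \<le> \<bar>\<Sum>j\<in>J. centred j \<omega>\<bar>} \<le> 2 * exp (- a\<^sup>2 / (4 * real n))"
proof -
  let ?B = "\<Union>j\<in>J. D j"
  have fin: "finite J" using J finite_subset by blast
  have B: "?B \<in> sets \<mu>" "emeasure \<mu> ?B < \<infinity>"
    using fin D(1) by (auto simp: emeasure_UN_unit of_nat_less_top)
  have mB: "measure \<mu> ?B = card J" by (simp add: measure_def emeasure_UN_unit fin)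
  have "card J \<le> n" using J card_mono[of "{..<n}" J] by simp
  have [measurable]: "point_count \<xi> ?B \<in> borel_measurable M" by (rule random_variable_count[OF B(1)])
  have "prob {\<omega> \<in> space M. a \<le> \<bar>\<Sum>j\<in>J. centred j \<omega>\<bar>}
      = prob {\<omega> \<in> space M. a \<le> \<bar>enn2real (point_count \<xi> ?B \<omega>) - measure \<mu> ?B\<bar>}"
  proof (rule measure_eq_AE)
    show "AE \<omega> in M. \<omega> \<in> {\<omega> \<in> space M. a \<le> \<bar>\<Sum>j\<in>J. centred j \<omega>\<bar>}
      \<longleftrightarrow> \<omega> \<in> {\<omega> \<in> space M. a \<le> \<bar>enn2real (point_count \<xi> ?B \<omega>) - measure \<mu> ?B\<bar>}"
      using AE_counts_finite by eventually_elim (simp add: sum_centred[OF fin] mB)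
  qed measurable
  also have "\<dots> \<le> 2 * exp (- a\<^sup>2 / (4 * real n))"
    using \<open>card J \<le> n\<close> n a by (intro prob_count_deviation B) (auto simp: mB)
  finally show ?thesis .
qed

lemma prob_max_sum_centred:
  assumes n: "0 < n" and a: "0 \<le> a" "a \<le> 2 * real n"
    and small: "2 * exp (- a\<^sup>2 / (4 * real n)) \<le> 1 / 2"
  shows "prob {\<omega> \<in> space M. \<exists>j\<le>n. 2 * a \<le> \<bar>\<Sum>i<j. centred i \<omega>\<bar>} \<le> 4 * exp (- a\<^sup>2 / (4 * real n))"
proof -
  have "indep_vars (\<lambda>_. borel) (\<lambda>i. point_count \<xi> (D i)) {..<n}"
    by (rule indep_counts) (rule D(1) disjoint_on)+
  then have "indep_vars (\<lambda>_. borel) (\<lambda>i \<omega>. enn2real (point_count \<xi> (D i) \<omega>) - 1) {..<n}"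
    by (rule indep_vars_compose2) measurable
  then have "indep_vars (\<lambda>_. borel) centred {..<n}" by (simp add: centred_def[abs_def])
  then have "prob {\<omega> \<in> space M. \<exists>j\<le>n. 2 * a \<le> \<bar>\<Sum>i<j. centred i \<omega>\<bar>}
    \<le> 2 * prob {\<omega> \<in> space M. a \<le> \<bar>\<Sum>i<n. centred i \<omega>\<bar>}"
  proof (rule ottaviani_inequality)
    fix j assume "j \<le> n"
    have "prob {\<omega> \<in> space M. a \<le> \<bar>\<Sum>i\<in>{j..<n}. centred i \<omega>\<bar>} \<le> 2 * exp (- a\<^sup>2 / (4 * real n))"
      by (rule prob_sum_centred[OF _ n a]) auto
    with small show "prob {\<omega> \<in> space M. a \<le> \<bar>\<Sum>i\<in>{j..<n}. centred i \<omega>\<bar>} \<le> 1 / 2" by linarith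
  qed
  with prob_sum_centred[OF order_refl n a] show ?thesis by linarith
qed

text \<open>The level is chosen with a^2 / (4 * 2^p) = 2 ln p, so that the tail is of order 1 / p^2
  and Borel-Cantelli applies. As p is about log 2 t, this ln p is the source of the iterated
  logarithm.\<close>

lemma AE_dyadic_maxima:
  "AE \<omega> in M. \<forall>\<^sub>F p in sequentially. \<forall>j\<le>2 ^ p. \<bar>\<Sum>i<j. centred i \<omega>\<bar> < 2 * sqrt (8 * 2 ^ p * ln (real p))"
proof -
  define a where "a p = sqrt (8 * 2 ^ p * ln (real p))" for p :: nat
  define E where "E p = {\<omega> \<in> space M. \<exists>j\<le>2 ^ p. 2 * a p \<le> \<bar>\<Sum>i<j. centred i \<omega>\<bar>}" for p :: nat
  have E: "E p \<in> events" for p unfolding E_def by measurable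
  have bound: "prob (E p) \<le> 4 * (1 / real p ^ 2)" if p: "2 \<le> p" for p
  proof -
    have sq: "(a p)\<^sup>2 = 8 * 2 ^ p * ln (real p)" using p by (simp add: a_def)
    have "exp (- (a p)\<^sup>2 / (4 * real (2 ^ p))) = exp (- (2 * ln (real p)))" by (simp add: sq)
    also have "\<dots> = 1 / real p ^ 2"
      using p by (simp add: exp_minus exp_double inverse_eq_divide)
    finally have e: "exp (- (a p)\<^sup>2 / (4 * real (2 ^ p))) = 1 / real p ^ 2" .
    have "(2::real) ^ 2 \<le> real p ^ 2" using p by (intro power_mono) auto
    then have small: "2 * exp (- (a p)\<^sup>2 / (4 * real (2 ^ p))) \<le> 1 / 2"
      unfolding e using p by (simp add: divide_le_eq)
    have "ln (real p) \<le> real p - 1" using p by (intro ln_le_minus_one) auto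
    \<comment> \<open>It yields 2 ln p \<le> 2^p, which is exactly the side condition a \<le> 2 *
      2^p of the tail bound.\<close>
    have "real p \<le> 2 ^ (p - 1)"
      using less_exp[of "p - 1"] p by (metis One_nat_def Suc_leI Suc_pred' less_le_trans of_nat_le_iff of_nat_numeral of_nat_power pos2)
    then have "2 * ln (real p) \<le> 2 ^ p"
      using \<open>ln (real p) \<le> real p - 1\<close> p by (cases p) auto
    then have "(a p)\<^sup>2 \<le> (2 * real (2 ^ p))\<^sup>2"
      unfolding sq using mult_left_mono[of "2 * ln (real p)" "2 ^ p" "4 * 2 ^ p"]
      by (simp add: power2_eq_square algebra_simps)
    then have "a p \<le> 2 * real (2 ^ p)" by (rule power2_le_imp_le) simp
    then have "prob (E p) \<le> 4 * exp (- (a p)\<^sup>2 / (4 * real (2 ^ p)))"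
      unfolding E_def using p by (intro prob_max_sum_centred small) (auto simp: a_def)
    then show ?thesis unfolding e .
  qed
  have "summable (\<lambda>p. prob (E p))"
  proof (rule summable_comparison_test_ev)
    show "\<forall>\<^sub>F p in sequentially. norm (prob (E p)) \<le> 4 * (1 / real p ^ 2)"
      using eventually_ge_at_top[of 2] by eventually_elim (simp only: real_norm_def abs_of_nonneg measure_nonneg bound)
    show "summable (\<lambda>p. 4 * (1 / real p ^ 2))"
      using inverse_power_summable[of 2, where ?'a = real] by (intro summable_mult) (simp add: inverse_eq_divide)
  qed
  then have "AE \<omega> in M. eventually (\<lambda>p. \<omega> \<in> space M - E p) sequentially"
    using E by (intro borel_cantelli_AE1) (auto simp: emeasure_eq_measure)
  then show ?thesis
  proof eventually_elim
    case (elim \<omega>)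
    then show ?case
    proof eventually_elim
      case (elim p)
      show ?case
      proof (intro allI impI, rule ccontr)
        fix j :: nat assume "j \<le> 2 ^ p" "\<not> \<bar>\<Sum>i<j. centred i \<omega>\<bar> < 2 * sqrt (8 * 2 ^ p * ln (real p))"
        then have "\<omega> \<in> E p" using elim unfolding E_def a_def not_less by blast
        with elim show False by blast
      qed
    qed
  qed
qed

text \<open>The dyadic level 2^p with p the ceiling of log 2 t lies between t and 2 t, so the
  maximum over its block controls time t at the cost of a constant factor.\<close>

lemma AE_count_lil:
  "AE \<omega> in M. (\<forall>t. finite (\<xi> \<omega> \<inter> (\<Union>j<t. D j))) \<and>
     (\<exists>K. \<forall>t\<ge>K. \<bar>real (card (\<xi> \<omega> \<inter> (\<Union>j<t. D j))) - real t\<bar> \<le> 12 * lil (real t))"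
  using AE_dyadic_maxima AE_counts_finite
proof eventually_elim
  case (elim \<omega>)
  have cnt: "finite (\<xi> \<omega> \<inter> (\<Union>j<t. D j)) \<and>
      enn2real (point_count \<xi> (\<Union>j<t. D j) \<omega>) = real (card (\<xi> \<omega> \<inter> (\<Union>j<t. D j)))" for t
  proof -
    from choice[OF elim(2)] obtain k :: "nat \<Rightarrow> nat"
      where k: "\<And>j. point_count \<xi> (D j) \<omega> = of_nat (k j)" by blast
    have "point_count \<xi> (\<Union>j<t. D j) \<omega> = of_nat (\<Sum>j<t. k j)"
      by (simp add: point_count_UN[OF _ disjoint_on] k)
    then have ne: "point_count \<xi> (\<Union>j<t. D j) \<omega> \<noteq> \<infinity>" by (simp del: of_nat_sum)
    then have fin: "finite (\<xi> \<omega> \<inter> (\<Union>j<t. D j))"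
      unfolding point_count_def by (metis emeasure_count_space_infinite infinity_ennreal_def subset_UNIV)
    then show ?thesis by (simp add: point_count_def emeasure_count_space enn2real_of_nat)
  qed
  define p where "p t = nat \<lceil>log 2 (real t)\<rceil>" for t :: nat
  have "filterlim p at_top sequentially" unfolding p_def by real_asymp
  with elim(1) have "\<forall>\<^sub>F t in sequentially. \<forall>j\<le>2 ^ p t.
      \<bar>\<Sum>i<j. centred i \<omega>\<bar> < 2 * sqrt (8 * 2 ^ p t * ln (real (p t)))"
    by (rule eventually_compose_filterlim)
  moreover have "\<forall>\<^sub>F t::nat in sequentially. 2 * sqrt (8 * (2 * real t) * ln (log 2 (real t) + 1)) \<le> 12 * lil (real t)"
    by (rule eventually_compose_filterlim[OF dyadic_bound_lil filterlim_real_sequentially])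
  ultimately have "\<forall>\<^sub>F t in sequentially. \<bar>real (card (\<xi> \<omega> \<inter> (\<Union>j<t. D j))) - real t\<bar> \<le> 12 * lil (real t)"
    using eventually_ge_at_top[of 2]
  proof eventually_elim
    case (elim t)
    note t = elim(3)
    have "1 \<le> log 2 (real t)" using t by (subst le_log_iff) auto
    then have p: "log 2 (real t) \<le> real (p t)" "real (p t) \<le> log 2 (real t) + 1" "1 \<le> p t"
      unfolding p_def by linarith+
    have "real t = 2 powr log 2 (real t)" using t by simp
    also have "\<dots> \<le> 2 powr real (p t)" using p by (intro powr_mono) auto
    finally have "t \<le> 2 ^ p t" by (simp add: powr_realpow)
    have "(2::real) ^ p t = 2 powr real (p t)" by (simp add: powr_realpow)
    also have "\<dots> \<le> 2 powr (log 2 (real t) + 1)" using p by (intro powr_mono) auto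
    also have "\<dots> = 2 * real t" using t by (simp add: powr_add)
    finally have p2: "(2::real) ^ p t \<le> 2 * real t" .
    have "8 * 2 ^ p t * ln (real (p t)) \<le> 8 * (2 * real t) * ln (log 2 (real t) + 1)"
      using p p2 by (intro mult_mono) auto
    then have "\<bar>\<Sum>i<t. centred i \<omega>\<bar> \<le> 2 * sqrt (8 * (2 * real t) * ln (log 2 (real t) + 1))"
      using elim(1) \<open>t \<le> 2 ^ p t\<close> by (smt (verit) real_sqrt_le_mono)
    also have "\<dots> \<le> 12 * lil (real t)" by (rule elim(2))
    also have "(\<Sum>i<t. centred i \<omega>) = real (card (\<xi> \<omega> \<inter> (\<Union>j<t. D j))) - real t"
      using sum_centred[OF _ \<open>\<forall>j. \<exists>k. point_count \<xi> (D j) \<omega> = of_nat k\<close>, of "{..<t}"] cnt[of t] by simp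
    finally show ?case .
  qed
  then show ?case using cnt unfolding eventually_sequentially by blast
qed

end

end

section \<open>The intensity in unit-rate coordinates\<close>

lemma powr_neg_le_cancel:
  fixes b r :: real
  assumes "0 < c" "0 < b" "0 < r"
  shows "r powr (-c) \<le> b powr (-c) \<longleftrightarrow> b \<le> r"
  using assms powr_mono2'[of "-c" b r] powr_less_mono2_neg[of "-c" r b] by (cases "b \<le> r") auto

lemma emeasure_radial_atLeast:
  assumes "0 < \<alpha>" "0 < b"
  shows "emeasure (radial_measure \<alpha>) {b..} = ennreal (b powr (-\<alpha>))"
proof -
  have lim: "((\<lambda>r. - (r powr (-\<alpha>))) \<longlongrightarrow> - 0) at_top"
    using assms by (intro tendsto_minus tendsto_neg_powr filterlim_ident) auto
  have "emeasure (radial_measure \<alpha>) {b..} =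
      (\<integral>\<^sup>+r. ennreal (\<alpha> * r powr (- \<alpha> - 1)) * indicator {b..} r \<partial>restrict_space lborel {0<..})"
    unfolding radial_measure_def using assms
    by (intro emeasure_density) (auto simp: sets_restrict_space_iff intro!: measurable_restrict_space1)
  also have "\<dots> = (\<integral>\<^sup>+r. ennreal (\<alpha> * r powr (- \<alpha> - 1)) * indicator {b..} r * indicator {0<..} r \<partial>lborel)"
    by (rule nn_integral_restrict_space) simp
  also have "\<dots> = (\<integral>\<^sup>+r. ennreal (\<alpha> * r powr (- \<alpha> - 1)) * indicator {b..} r \<partial>lborel)"
    using assms by (intro nn_integral_cong) (auto simp: indicator_def)
  also have "\<dots> = ennreal (- 0 - (- (b powr (-\<alpha>))))"
  proof (rule nn_integral_FTC_atLeast[OF _ _ _ lim])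
    show "DERIV (\<lambda>r. - (r powr (-\<alpha>))) r :> \<alpha> * r powr (- \<alpha> - 1)" if "b \<le> r" for r
      using that assms by (auto intro!: derivative_eq_intros simp: powr_diff)
  qed (use assms in auto)
  finally show ?thesis by simp
qed

text \<open>
  The points whose coordinate \<open>u = v * norm x powr (-\<alpha>)\<close> lies in \<open>{j<..j + 1}\<close>; in this coordinate
  the intensity on the ray is Lebesgue measure.
\<close>

definition shell :: "real \<Rightarrow> real \<Rightarrow> 'a::euclidean_space \<Rightarrow> nat \<Rightarrow> 'a set" where
  "shell \<alpha> v e j = {x. norm x \<in> {r. 0 < r \<and> real j < v * r powr (-\<alpha>) \<and> v * r powr (-\<alpha>) \<le> real (Suc j)} \<and>
     x /\<^sub>R norm x \<in> {e}}"

text \<open>The radii with coordinate at most t form a half-line of mass t / v. A cell is a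
  difference of two such half-lines, and its mass 1 / v cancels against the spherical atom
  v.\<close>

lemma emeasure_radial_shell:
  assumes \<alpha>: "0 < \<alpha>" and v: "0 < v"
  defines "B \<equiv> \<lambda>j. {r. 0 < r \<and> real j < v * r powr (-\<alpha>) \<and> v * r powr (-\<alpha>) \<le> real (Suc j)}"
  shows "B j \<in> sets borel" "emeasure (radial_measure \<alpha>) (B j) = ennreal (1 / v)"
proof -
  define T where "T t = {r. 0 < r \<and> v * r powr (-\<alpha>) \<le> t}" for t
  define b where "b t = (t / v) powr (- 1 / \<alpha>)" for t
  have T: "T t = {b t..}" "0 < b t" "b t powr (-\<alpha>) = t / v" if t: "0 < t" for t
  proof -
    show b: "0 < b t" using t v by (simp add: b_def)
    show *: "b t powr (-\<alpha>) = t / v" using t v \<alpha> by (simp add: b_def powr_powr)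
    have "v * r powr (-\<alpha>) \<le> t \<longleftrightarrow> b t \<le> r" if "0 < r" for r
      using powr_neg_le_cancel[OF \<alpha> b that] v unfolding * by (simp add: field_simps)
    then show "T t = {b t..}" using b by (auto simp: T_def)
  qed
  have ms: "{b t..} \<in> sets (radial_measure \<alpha>)" if "0 < t" for t
    using T(2)[OF that] by (auto simp: radial_measure_def sets_restrict_space_iff)
  have eT: "emeasure (radial_measure \<alpha>) {b t..} = ennreal (t / v)" if "0 < t" for t
    using emeasure_radial_atLeast[OF \<alpha> T(2)[OF that]] T(3)[OF that] by simp
  have "B j \<in> sets borel \<and> emeasure (radial_measure \<alpha>) (B j) = ennreal (1 / v)"
  proof (cases "j = 0")
    \<comment> \<open>Coordinate 0 corresponds to infinite radius, so the first cell is a whole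
      half-line and not a difference of two.\<close>
    case True
    then have "B j = T 1" using v by (auto simp: B_def T_def)
    then show ?thesis using eT[of 1] by (simp add: T)
  next
    case False
    then have "B j = T (real (Suc j)) - T (real j)" by (auto simp: B_def T_def)
    then have B: "B j = {b (real (Suc j))..} - {b (real j)..}" using False by (simp add: T)
    have "T (real j) \<subseteq> T (real (Suc j))" by (auto simp: T_def)
    then have "{b (real j)..} \<subseteq> {b (real (Suc j))..}" using False T(1) by simp
    then have "emeasure (radial_measure \<alpha>) (B j) = ennreal (real (Suc j) / v) - ennreal (real j / v)"
      unfolding B using False by (subst emeasure_Diff) (simp_all add: ms eT del: of_nat_Suc)
    also have "\<dots> = ennreal (real (Suc j) / v - real j / v)"
      using v by (intro ennreal_minus) simp
    also have "real (Suc j) / v - real j / v = 1 / v"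
      by (simp add: diff_divide_distrib[symmetric])
    finally show ?thesis by (simp add: B)
  qed
  then show "B j \<in> sets borel" "emeasure (radial_measure \<alpha>) (B j) = ennreal (1 / v)" by auto
qed

lemma disjoint_family_shell: "disjoint_family (shell \<alpha> v e)"
proof -
  have "i = j" if "real i < u" "u \<le> real (Suc i)" "real j < u" "u \<le> real (Suc j)" for u i j
    using that by linarith
  then show ?thesis unfolding disjoint_family_on_def shell_def by blast
qed

lemma emeasure_shell:
  fixes \<nu> :: "'a::euclidean_space measure"
  assumes \<alpha>: "0 < \<alpha>" and \<nu>: "prob_space \<nu>" "sets \<nu> = sets (restrict_space borel (sphere 0 1))"
    and e: "norm e = 1" "0 < measure \<nu> {e}"
  shows "emeasure (polar_intensity \<alpha> \<nu>) (shell \<alpha> (measure \<nu> {e}) e j) = 1"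
proof -
  interpret prob_space \<nu> by fact
  let ?B = "{r. 0 < r \<and> real j < measure \<nu> {e} * r powr (-\<alpha>) \<and> measure \<nu> {e} * r powr (-\<alpha>) \<le> real (Suc j)}"
  have "emeasure (polar_intensity \<alpha> \<nu>) (shell \<alpha> (measure \<nu> {e}) e j)
      = emeasure (radial_measure \<alpha>) ?B * emeasure \<nu> {e}"
    unfolding shell_def
    by (rule emeasure_polar_intensity[OF \<nu>]) (use emeasure_radial_shell[OF \<alpha> e(2)] e in auto)
  also have "\<dots> = ennreal (1 / measure \<nu> {e}) * ennreal (measure \<nu> {e})"
    using emeasure_radial_shell(2)[OF \<alpha> e(2)] by (simp add: emeasure_eq_measure)
  also have "\<dots> = 1" using e by (simp flip: ennreal_mult)
  finally show ?thesis .
qed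

text \<open>Counting points in the first t shells becomes counting coordinates up to t, as
  \<open>lil_enumeration\<close> requires. The factor \<open>v powr (1 / \<alpha>)\<close> that
  normalises the coordinate to unit rate is the length of the corresponding vector in
  \<open>A\<close>.\<close>

lemma bij_betw_shells:
  fixes e :: "'a::euclidean_space"
  assumes \<alpha>: "0 < \<alpha>" and v: "0 < v" and e: "norm e = 1"
  shows "bij_betw (\<lambda>u. u powr (- (1 / \<alpha>)) *\<^sub>R v powr (1 / \<alpha>) *\<^sub>R e)
    {u. 0 < u \<and> u \<le> real t \<and> u powr (- (1 / \<alpha>)) *\<^sub>R v powr (1 / \<alpha>) *\<^sub>R e \<in> S}
    (S \<inter> (\<Union>j<t. shell \<alpha> v e j))"
proof -
  let ?f = "\<lambda>u. u powr (- (1 / \<alpha>)) *\<^sub>R v powr (1 / \<alpha>) *\<^sub>R e" and ?g = "\<lambda>x. v * norm x powr (-\<alpha>)"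
  have norm_f: "norm (?f u) = u powr (- (1 / \<alpha>)) * v powr (1 / \<alpha>)" for u by (simp add: e)
  have gf: "?g (?f u) = u" if "0 < u" for u
  proof -
    have "?g (?f u) = v * ((u powr (- (1 / \<alpha>))) powr (-\<alpha>) * (v powr (1 / \<alpha>)) powr (-\<alpha>))"
      unfolding norm_f by (simp add: powr_mult)
    also have "(u powr (- (1 / \<alpha>))) powr (-\<alpha>) = u" using that \<alpha> by (simp add: powr_powr)
    also have "(v powr (1 / \<alpha>)) powr (-\<alpha>) = 1 / v" using \<alpha> v by (simp add: powr_powr powr_neg_one)
    finally show ?thesis using v by simp
  qed
  have in_shell: "?f u \<in> shell \<alpha> v e j \<longleftrightarrow> real j < u \<and> u \<le> real (Suc j)" if "0 < u" for u j
  proof -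
    have pos: "0 < u powr (- (1 / \<alpha>)) * v powr (1 / \<alpha>)" using that v by simp
    have "?f u /\<^sub>R norm (?f u) = (inverse (norm (?f u)) * norm (?f u)) *\<^sub>R e"
      unfolding norm_f by simp
    also have "\<dots> = e" unfolding norm_f using pos by (subst left_inverse) auto
    finally have "?f u /\<^sub>R norm (?f u) = e" .
    moreover have "0 < norm (?f u)" unfolding norm_f by (rule pos)
    ultimately show ?thesis unfolding shell_def mem_Collect_eq gf[OF that] by simp
  qed
  have fg: "?f (?g x) = x" "0 < ?g x" if "x \<in> shell \<alpha> v e j" for x j
  proof -
    have x: "0 < norm x" "x /\<^sub>R norm x = e" using that by (auto simp: shell_def)
    have "(norm x powr (-\<alpha>)) powr (- (1 / \<alpha>)) = norm x" using \<alpha> by (simp add: powr_powr)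
    moreover have "v powr (- (1 / \<alpha>)) * v powr (1 / \<alpha>) = 1" using v by (simp flip: powr_add)
    ultimately have "(v * norm x powr (-\<alpha>)) powr (- (1 / \<alpha>)) * v powr (1 / \<alpha>) = norm x"
      using v by (simp add: powr_mult)
    then have "?f (?g x) = norm x *\<^sub>R e" by simp
    also have "\<dots> = x" unfolding x(2)[symmetric] using x(1) by simp
    finally show "?f (?g x) = x" .
    show "0 < ?g x" using x v by simp
  qed
  show ?thesis
  proof (rule bij_betw_byWitness[where f' = ?g])
    show "\<forall>u\<in>{u. 0 < u \<and> u \<le> real t \<and> ?f u \<in> S}. ?g (?f u) = u" using gf by blast
    show "\<forall>x\<in>S \<inter> (\<Union>j<t. shell \<alpha> v e j). ?f (?g x) = x" using fg(1) by blast
    show "?f ` {u. 0 < u \<and> u \<le> real t \<and> ?f u \<in> S} \<subseteq> S \<inter> (\<Union>j<t. shell \<alpha> v e j)"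
    proof (rule image_subsetI)
      fix u assume "u \<in> {u. 0 < u \<and> u \<le> real t \<and> ?f u \<in> S}"
      then have u: "0 < u" "u \<le> real t" "?f u \<in> S" by auto
      \<comment> \<open>Cells are open on the left and closed on the right, hence the ceiling minus
        1 and not the floor.\<close>
      define j where "j = nat (\<lceil>u\<rceil> - 1)"
      have "real j < u" "u \<le> real (Suc j)" "j < t"
        using u(1,2) unfolding j_def by linarith+
      then have "?f u \<in> shell \<alpha> v e j" using in_shell[OF u(1), of j] by simp
      with u(3) \<open>j < t\<close> show "?f u \<in> S \<inter> (\<Union>j<t. shell \<alpha> v e j)" by blast
    qed
    show "?g ` (S \<inter> (\<Union>j<t. shell \<alpha> v e j)) \<subseteq> {u. 0 < u \<and> u \<le> real t \<and> ?f u \<in> S}"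
    proof (rule image_subsetI)
      fix x assume "x \<in> S \<inter> (\<Union>j<t. shell \<alpha> v e j)"
      then obtain j where x: "x \<in> S" "j < t" "x \<in> shell \<alpha> v e j" by blast
      have "?g x \<le> real (Suc j)" using x(3) by (simp add: shell_def)
      also have "\<dots> \<le> real t" using x(2) by simp
      finally have "?g x \<le> real t" .
      with fg[OF x(3)] x(1) show "?g x \<in> {u. 0 < u \<and> u \<le> real t \<and> ?f u \<in> S}" by simp
    qed
  qed
qed

section \<open>Limit of the convex hulls\<close>

theorem theorem1:
  fixes \<alpha> :: real
    and \<nu> :: "(real ^ 'd) measure"
    and l :: nat
    and e :: "nat \<Rightarrow> real ^ 'd"
    and M :: "'w measure"
    and \<xi> :: "'w \<Rightarrow> (real ^ 'd) set"
    and A Cinf :: "(real ^ 'd) set"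
  assumes "\<alpha> > 0"
    and "sets \<nu> = sets (restrict_space borel (sphere 0 1))"
    and "emeasure \<nu> (sphere 0 1) = 1"
    and "inj_on e {1..l}"
    and "\<And>i. i \<in> {1..l} \<Longrightarrow> norm (e i) = 1"
    and "emeasure \<nu> (sphere 0 1 - e ` {1..l}) = 0"
    and "\<And>i. i \<in> {1..l} \<Longrightarrow> measure \<nu> {e i} > 0"
    and "convex_cone hull (e ` {1..l}) = UNIV"
    and "poisson_process M (polar_intensity \<alpha> \<nu>) \<xi>"
    and "A = (\<lambda>i. measure \<nu> {e i} powr (1 / \<alpha>) *\<^sub>R e i) ` {1..l}"
    and "Cinf = convex hull A"
    and "extreme_set A"
  shows "(AE \<omega> in M. \<exists>(m::real) K. K \<ge> 3 \<and>
           (\<forall>k\<ge>K. hausdorff_distance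
              ((\<lambda>x. real k powr (1 / \<alpha>) *\<^sub>R x) ` peel_hull (\<xi> \<omega>) k) Cinf
                \<le> m * sqrt (ln (ln (real k)) / real k))) \<and>
         (AE \<omega> in M.
           (\<lambda>k. hausdorff_distance
              ((\<lambda>x. x /\<^sub>R max_norm (peel_hull (\<xi> \<omega>) k)) ` peel_hull (\<xi> \<omega>) k)
              ((\<lambda>x. x /\<^sub>R max_norm Cinf) ` Cinf)) \<longlonglongrightarrow> 0)"
proof -
  note \<alpha> = assms(1) and sets_\<nu> = assms(2) and inj_e = assms(4) and norm_e = assms(5)
    and null = assms(6) and v_pos = assms(7) and cone = assms(8) and A = assms(10) and Cinf = assms(11)
  define I where "I = {1..l}"
  define v where "v i = measure \<nu> {e i}" for i
  define \<beta> where "\<beta> = 1 / \<alpha>"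
  define a where "a i = v i powr \<beta> *\<^sub>R e i" for i
  have v: "0 < v i" if "i \<in> I" for i using v_pos that by (simp add: v_def I_def)
  have ne: "norm (e i) = 1" if "i \<in> I" for i using norm_e that by (simp add: I_def)
  have \<beta>: "0 < \<beta>" using \<alpha> by (simp add: \<beta>_def)
  have space_\<nu>: "space \<nu> = sphere 0 1"
    using sets_eq_imp_space_eq[OF sets_\<nu>] by (simp add: space_restrict_space)
  have prob_\<nu>: "prob_space \<nu>" by (rule prob_spaceI) (simp add: space_\<nu> assms(3))
  interpret poisson_process M "polar_intensity \<alpha> \<nu>" \<xi> by fact

  have A': "A = a ` I" unfolding A by (simp add: a_def v_def \<beta>_def I_def)
  have ext_A: "ext (convex hull (a ` I)) = a ` I" and "DIM(real ^ 'd) + 1 \<le> card (a ` I)"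
    using assms(12) unfolding extreme_set_def A' by auto
  then have "I \<noteq> {}" by auto
  have "finite I" by (simp add: I_def)
  have nz: "a i \<noteq> 0" if "i \<in> I" for i using v[OF that] ne[OF that] by (auto simp: a_def)
  have distinct: "s *\<^sub>R a i \<noteq> t *\<^sub>R a j" if "i \<in> I" "j \<in> I" "i \<noteq> j" "0 < s" "0 < t" for i j s t
  proof
    assume eq: "s *\<^sub>R a i = t *\<^sub>R a j"
    then have "norm (s *\<^sub>R a i) = norm (t *\<^sub>R a j)" by simp
    then have "s * v i powr \<beta> = t * v j powr \<beta>" using that by (simp add: a_def ne)
    moreover have "s * v i powr \<beta> \<noteq> 0" using that v[OF that(1)] by simp
    ultimately have "e i = e j" using eq by (simp add: a_def)
    then show False using inj_e that by (auto simp: I_def dest: inj_onD)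
  qed
  have inj_a: "inj_on a I" using distinct[of _ _ 1 1] by (auto intro!: inj_onI)
  have zero: "0 \<in> convex hull ((\<lambda>i. w i *\<^sub>R a i) ` I)" if "\<And>i. i \<in> I \<Longrightarrow> 0 < w i" for w
  proof -
    have "0 \<in> convex hull ((\<lambda>i. (w i * v i powr \<beta>) *\<^sub>R e i) ` I)"
    proof (rule zero_in_convex_hull_of_cone)
      show "0 < w i * v i powr \<beta>" if "i \<in> I" for i
        using v[OF that] \<open>\<And>i. i \<in> I \<Longrightarrow> 0 < w i\<close>[OF that] by simp
    qed (use inj_e cone \<open>finite I\<close> \<open>I \<noteq> {}\<close> in \<open>auto simp: I_def\<close>)
    then show ?thesis by (simp add: a_def)
  qed

  have AE_lil: "AE \<omega> in M. \<forall>i\<in>I. (\<forall>t. finite (\<xi> \<omega> \<inter> (\<Union>j<t. shell \<alpha> (v i) (e i) j))) \<and>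
     (\<exists>K. \<forall>t\<ge>K. \<bar>real (card (\<xi> \<omega> \<inter> (\<Union>j<t. shell \<alpha> (v i) (e i) j))) - real t\<bar> \<le> 12 * lil (real t))"
  proof (rule AE_finite_allI[OF \<open>finite I\<close>])
    fix i assume i: "i \<in> I"
    have unit: "emeasure (polar_intensity \<alpha> \<nu>) (shell \<alpha> (v i) (e i) j) = 1" for j
      using emeasure_shell[OF \<alpha> prob_\<nu> sets_\<nu> ne[OF i]] v[OF i] by (simp add: v_def)
    \<comment> \<open>Measurability of the shells follows from their mass 1, because
      \<open>emeasure\<close> is 0 by default on non-measurable sets.\<close>
    show "AE \<omega> in M. (\<forall>t. finite (\<xi> \<omega> \<inter> (\<Union>j<t. shell \<alpha> (v i) (e i) j))) \<and>
       (\<exists>K. \<forall>t\<ge>K. \<bar>real (card (\<xi> \<omega> \<inter> (\<Union>j<t. shell \<alpha> (v i) (e i) j))) - real t\<bar> \<le> 12 * lil (real t))"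
      by (rule AE_count_lil[OF _ disjoint_family_shell unit]) (rule emeasure_neq_0_sets, simp add: unit)
  qed

  have AE_rays: "AE \<omega> in M. \<forall>x\<in>\<xi> \<omega>. x \<noteq> 0 \<and> x /\<^sub>R norm x \<in> e ` I"
  proof -
    let ?E = "sphere 0 1 - e ` I"
    let ?O = "{x :: real ^ 'd. norm x \<in> {0<..} \<and> x /\<^sub>R norm x \<in> ?E}"
    have E: "?E \<in> sets borel" using \<open>finite I\<close> by (intro sets.Diff borel_closed closed_sphere finite_imp_closed finite_imageI)
    have "?O \<in> sets borel"
    proof -
      have "(\<lambda>x::real ^ 'd. x /\<^sub>R norm x) -` ?E \<inter> space borel \<in> sets borel"
        by (rule measurable_sets[OF _ E]) simp
      moreover have "?O = ((\<lambda>x. x /\<^sub>R norm x) -` ?E \<inter> space borel) - {0}" by auto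
      ultimately show ?thesis by simp
    qed
    then have O: "?O \<in> sets (polar_intensity \<alpha> \<nu>)"
      by (auto simp: polar_intensity_def sets_restrict_space_iff)
    \<comment> \<open>The radial factor is infinite; the product vanishes by \<infinity> * 0 = 0 in
      \<open>ennreal\<close>.\<close>
    have "emeasure (polar_intensity \<alpha> \<nu>) ?O = emeasure (radial_measure \<alpha>) {0<..} * emeasure \<nu> ?E"
      by (rule emeasure_polar_intensity[OF prob_\<nu> sets_\<nu>]) (use E in auto)
    then have O0: "emeasure (polar_intensity \<alpha> \<nu>) ?O = 0" using null by (simp add: I_def)
    then have "prob {\<omega> \<in> space M. point_count \<xi> ?O \<omega> = of_nat 0} = 1"
      by (subst poisson_count[OF O]) (simp_all add: measure_def)
    then have "AE \<omega> in M. \<omega> \<in> {\<omega> \<in> space M. point_count \<xi> ?O \<omega> = of_nat 0}" by (rule AE_prob_1)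
    then show ?thesis
    proof eventually_elim
      case (elim \<omega>)
      then have "\<xi> \<omega> \<inter> ?O = {}" by (simp add: point_count_def emeasure_count_space_eq_0)
      moreover have "\<xi> \<omega> \<subseteq> - {0}"
        using points_in_space[of \<omega>] elim by (simp add: polar_intensity_def space_restrict_space)
      moreover have "x /\<^sub>R norm x \<in> sphere 0 1" if "x \<noteq> 0" for x :: "real ^ 'd" using that by simp
      ultimately show ?case by fastforce
    qed
  qed

  have key: "AE \<omega> in M. \<exists>s m. (\<forall>k\<ge>1. peel_hull (\<xi> \<omega>) k = convex hull ((\<lambda>i. s k i *\<^sub>R a i) ` I)) \<and>
           (\<forall>\<^sub>F k in sequentially. \<forall>i\<in>I. 0 < s k i \<and>
              \<bar>real k powr \<beta> * s k i - 1\<bar> \<le> m * sqrt (ln (ln (real k)) / real k))"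
    using AE_lil AE_rays
  proof eventually_elim
    case (elim \<omega>)
    define U where "U i = {u. 0 < u \<and> u powr (-\<beta>) *\<^sub>R a i \<in> \<xi> \<omega>}" for i
    have "\<exists>g. strict_mono g \<and> range g = U i \<and>
        (\<exists>m. \<forall>\<^sub>F j in sequentially. \<bar>g j - real j\<bar> \<le> m * lil (real j))" if i: "i \<in> I" for i
    proof -
      have bij: "bij_betw (\<lambda>u. u powr (-\<beta>) *\<^sub>R a i) {u \<in> U i. u \<le> real t}
          (\<xi> \<omega> \<inter> (\<Union>j<t. shell \<alpha> (v i) (e i) j))" for t
      proof -
        have "{u \<in> U i. u \<le> real t} = {u. 0 < u \<and> u \<le> real t \<and> u powr (-\<beta>) *\<^sub>R a i \<in> \<xi> \<omega>}"
          by (auto simp: U_def)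
        then show ?thesis
          using bij_betw_shells[OF \<alpha> v[OF i] ne[OF i], of t "\<xi> \<omega>"] by (simp only: a_def \<beta>_def)
      qed
      from elim(1) i obtain K where
        K: "\<And>t. K \<le> t \<Longrightarrow> \<bar>real (card (\<xi> \<omega> \<inter> (\<Union>j<t. shell \<alpha> (v i) (e i) j))) - real t\<bar> \<le> 12 * lil (real t)"
        by blast
      show ?thesis
      proof (rule lil_enumeration)
        show "0 < u" if "u \<in> U i" for u using that by (simp add: U_def)
        show "finite {u \<in> U i. u \<le> real t}" for t
          using bij_betw_finite[OF bij[of t]] elim(1) i by blast
        show "\<bar>real (card {u \<in> U i. u \<le> real t}) - real t\<bar> \<le> 12 * lil (real t)" if "K \<le> t" for t
          using K[OF that] by (simp only: bij_betw_same_card[OF bij])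
      qed
    qed
    then have "\<forall>i\<in>I. \<exists>g. strict_mono g \<and> range g = U i \<and>
        (\<exists>m. \<forall>\<^sub>F j in sequentially. \<bar>g j - real j\<bar> \<le> m * lil (real j))" by blast
    from bchoice[OF this] obtain g where g: "\<And>i. i \<in> I \<Longrightarrow> strict_mono (g i)"
      "\<And>i. i \<in> I \<Longrightarrow> range (g i) = U i"
      "\<And>i. i \<in> I \<Longrightarrow> \<exists>m. \<forall>\<^sub>F j in sequentially. \<bar>g i j - real j\<bar> \<le> m * lil (real j)"
      by blast
    have g_pos: "0 < g i j" if "i \<in> I" for i j
      using g(2)[OF that] by (auto simp: U_def)
    \<comment> \<open>This identifies the outcome with the configuration of
      \<open>peel_hull_rate\<close>; that no point is missed rests on
      \<open>AE_rays\<close>.\<close>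
    have "\<xi> \<omega> = {g i j powr (-\<beta>) *\<^sub>R a i | i j. i \<in> I}"
    proof (intro equalityI subsetI)
      fix x assume x: "x \<in> \<xi> \<omega>"
      with elim(2) obtain i where i: "i \<in> I" "x \<noteq> 0" "x /\<^sub>R norm x = e i" by blast
      define u where "u = v i * norm x powr (-\<alpha>)"
      have "0 < u" using i v by (simp add: u_def)
      have "(norm x powr (-\<alpha>)) powr (-\<beta>) = norm x" using \<alpha> by (simp add: \<beta>_def powr_powr)
      moreover have "v i powr (-\<beta>) * v i powr \<beta> = 1" using v[OF i(1)] by (simp flip: powr_add)
      ultimately have "u powr (-\<beta>) * v i powr \<beta> = norm x"
        using v[OF i(1)] by (simp add: u_def powr_mult)
      then have "u powr (-\<beta>) *\<^sub>R a i = norm x *\<^sub>R e i" by (simp add: a_def)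
      also have "\<dots> = x" unfolding i(3)[symmetric] using i(2) by simp
      finally have x_eq: "x = u powr (-\<beta>) *\<^sub>R a i" by simp
      then have "u \<in> range (g i)" using g(2)[OF i(1)] x \<open>0 < u\<close> by (simp add: U_def)
      then show "x \<in> {g i j powr (-\<beta>) *\<^sub>R a i | i j. i \<in> I}" using x_eq i(1) by blast
    next
      fix x assume "x \<in> {g i j powr (-\<beta>) *\<^sub>R a i | i j. i \<in> I}"
      then obtain i j where x: "x = g i j powr (-\<beta>) *\<^sub>R a i" "i \<in> I" by blast
      have "g i j \<in> U i" using g(2)[OF x(2)] by blast
      then show "x \<in> \<xi> \<omega>" by (simp add: U_def x(1))
    qed
    then show ?case
      using peel_hull_rate[OF \<open>finite I\<close> \<open>I \<noteq> {}\<close> inj_a ext_A distinct nz zero g(1) g_pos g(3) \<beta>] by simp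
  qed

  show ?thesis
  proof
    show "AE \<omega> in M. \<exists>(m::real) K. K \<ge> 3 \<and>
           (\<forall>k\<ge>K. hausdorff_distance
              ((\<lambda>x. real k powr (1 / \<alpha>) *\<^sub>R x) ` peel_hull (\<xi> \<omega>) k) Cinf
                \<le> m * sqrt (ln (ln (real k)) / real k))"
      using key
    proof eventually_elim
      case (elim \<omega>)
      then obtain s m where hull: "\<And>k. 1 \<le> k \<Longrightarrow> peel_hull (\<xi> \<omega>) k = convex hull ((\<lambda>i. s k i *\<^sub>R a i) ` I)"
        and "\<forall>\<^sub>F k in sequentially. \<forall>i\<in>I. 0 < s k i \<and>
              \<bar>real k powr \<beta> * s k i - 1\<bar> \<le> m * sqrt (ln (ln (real k)) / real k)" by blast
      then obtain K where K: "\<And>k i. \<lbrakk>K \<le> k; i \<in> I\<rbrakk> \<Longrightarrow>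
          \<bar>real k powr \<beta> * s k i - 1\<bar> \<le> m * sqrt (ln (ln (real k)) / real k)"
        unfolding eventually_sequentially by blast
      \<comment> \<open>The sum bounds each \<open>norm (a i)\<close>, and thus turns the error of
        the scale factors into one distance bound for all generators.\<close>
      define B where "B = (\<Sum>i\<in>I. norm (a i))"
      have "hausdorff_distance ((\<lambda>x. real k powr (1 / \<alpha>) *\<^sub>R x) ` peel_hull (\<xi> \<omega>) k) Cinf
          \<le> (m * B) * sqrt (ln (ln (real k)) / real k)" if k: "max 3 K \<le> k" for k
      proof -
        let ?c = "\<lambda>i. real k powr \<beta> * s k i"
        have "(\<lambda>x. real k powr (1 / \<alpha>) *\<^sub>R x) ` peel_hull (\<xi> \<omega>) k = convex hull ((\<lambda>i. ?c i *\<^sub>R a i) ` I)"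
          using hull[of k] k by (simp add: convex_hull_scaling[symmetric] image_image \<beta>_def)
        moreover have "norm (?c i *\<^sub>R a i - a i) \<le> (m * B) * sqrt (ln (ln (real k)) / real k)"
          if i: "i \<in> I" for i
        proof -
          have "?c i *\<^sub>R a i - a i = (?c i - 1) *\<^sub>R a i" by (simp add: scaleR_diff_left)
          then have "norm (?c i *\<^sub>R a i - a i) = \<bar>?c i - 1\<bar> * norm (a i)" by simp
          also have "\<dots> \<le> (m * sqrt (ln (ln (real k)) / real k)) * B"
            using K[of k i] k i \<open>finite I\<close> unfolding B_def
            by (intro mult_mono member_le_sum) (auto intro: order_trans[OF abs_ge_zero])
          finally show ?thesis by (simp add: mult_ac)
        qed
        ultimately show ?thesis
          unfolding Cinf A' by (simp only: hausdorff_distance_convex_hull_image[OF \<open>finite I\<close> \<open>I \<noteq> {}\<close>])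
      qed
      then show ?case by (intro exI[of _ "m * B"] exI[of _ "max 3 K"]) simp
    qed
    show "AE \<omega> in M.
           (\<lambda>k. hausdorff_distance
              ((\<lambda>x. x /\<^sub>R max_norm (peel_hull (\<xi> \<omega>) k)) ` peel_hull (\<xi> \<omega>) k)
              ((\<lambda>x. x /\<^sub>R max_norm Cinf) ` Cinf)) \<longlonglongrightarrow> 0"
      using key
    proof eventually_elim
      case (elim \<omega>)
      then obtain s m where hull: "\<And>k. 1 \<le> k \<Longrightarrow> peel_hull (\<xi> \<omega>) k = convex hull ((\<lambda>i. s k i *\<^sub>R a i) ` I)"
        and rate: "\<forall>\<^sub>F k in sequentially. \<forall>i\<in>I. 0 < s k i \<and>
              \<bar>real k powr \<beta> * s k i - 1\<bar> \<le> m * sqrt (ln (ln (real k)) / real k)" by blast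
      have "(\<lambda>k. ln (ln (real k)) / real k) \<longlonglongrightarrow> 0" by real_asymp
      then have "(\<lambda>k. m * sqrt (ln (ln (real k)) / real k)) \<longlonglongrightarrow> m * sqrt 0"
        by (intro tendsto_intros)
      then have lim: "(\<lambda>k. m * sqrt (ln (ln (real k)) / real k)) \<longlonglongrightarrow> 0" by simp
      have scale: "(\<lambda>k. real k powr \<beta> * s k i) \<longlonglongrightarrow> 1" if i: "i \<in> I" for i
      proof -
        have "(\<lambda>k. real k powr \<beta> * s k i - 1) \<longlonglongrightarrow> 0"
          by (rule Lim_null_comparison[OF _ lim])
            (use rate i in \<open>auto elim!: eventually_mono\<close>)
        then show ?thesis by (simp add: LIM_zero_iff)
      qed
      show ?case
        unfolding Cinf A'
        by (rule normalized_hull_tendsto[OF \<open>finite I\<close> \<open>I \<noteq> {}\<close> nz hull scale])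
    qed
  qed
qed

end
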